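(* Let $X$ be a separable complex Banach space which admits an unconditional Schauder decomposition. Then $X$ is a universal Jamison space for $C_0$-semigroups.
   Context: For a $C_0$-semigroup $(T_t)_{t\ge 0}$ of bounded linear operators on a complex Banach space, with infinitesimal generator $A$, $\sigma_p(A)$ denotes the point spectrum (set of eigenvalues) of $A$. The semigroup is (partially) bounded with respect to a sequence $(t_k)_{k\ge 0}$ of positive real numbers if $\sup_{k\ge 0}\|T_{t_k}\|<+\infty$. Throughout, the sequences $(t_k)_{k\ge0}$ considered are increasing sequences of positive real numbers tending to infinity. Such a sequence is a Jamison sequence for $C_0$-semigroups if for every separable complex Banach space $Y$ and every $C_0$-semigroup $(T_t)_{t\ge 0}$ of bounded linear operators on $Y$ (with infinitesimal generator $A$) which is partially bounded with respect to $(t_k)_{k\ge 0}$, the set $\sigma_p(A)\cap i\mathbb{R}$ is at most countable. A separable infinite-dimensional complex Banach space $X$ is a universal Jamison space for $C_0$-semigroups if for any such increasing sequence of positive real numbers $(t_k)_{k\ge 0}$ (tending to infinity) which is not a Jamison sequence for $C_0$-semigroups, there exists a $C_0$-semigroup $(T_t)_{t\ge 0}$ of bounded linear operators on $X$ (with infinitesimal generator $A$) which is bounded with respect to $(t_k)_{k\ge 0}$ and such that the set $\sigma_p(A)\cap i\mathbb{R}$ is uncountable. A separable infinite-dimensional complex Banach space $X$ admits an unconditional Schauder decomposition if there exists a sequence $(X_\ell)_{\ell\ge 1}$ of closed subspaces of $X$, all different from $\{0\}$, such that any $x\in X$ can be written in a unique way as an unconditionally convergent series $\sum_{\ell\ge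 1}x_\ell$ with $x_\ell\in X_\ell$ for all $\ell\geq 1$. *)

theory Defs
  imports "HOL-Analysis.Analysis"
begin

section \<open>Complex Banach spaces\<close>

text \<open>
  The space \<open>X\<close> is a type of the following class. The spaces \<open>Y\<close> over which the definition of a
  Jamison sequence quantifies have to be values rather than types, because HOL formulas cannot
  quantify over types; they are records with an explicit carrier. The semigroup notions are defined
  once, for records, and apply to \<open>X\<close> through \<open>space_of_type\<close>.
\<close>

class complex_banach = banach +
  fixes scaleC :: "complex \<Rightarrow> 'a \<Rightarrow> 'a"
  assumes scaleC_add_right: "scaleC a (x + y) = scaleC a x + scaleC a y"
    and scaleC_add_left: "scaleC (a + b) x = scaleC a x + scaleC b x"
    and scaleC_scaleC: "scaleC a (scaleC b x) = scaleC (a * b) x"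
    and scaleC_of_real: "scaleC (complex_of_real r) x = r *\<^sub>R x"
    and norm_scaleC: "norm (scaleC a x) = cmod a * norm x"

record 'a cspace =
  cs_carrier :: "'a set"
  cs_zero :: 'a
  cs_add :: "'a \<Rightarrow> 'a \<Rightarrow> 'a"
  cs_scale :: "complex \<Rightarrow> 'a \<Rightarrow> 'a"
  cs_norm :: "'a \<Rightarrow> real"

definition cs_diff :: "'a cspace \<Rightarrow> 'a \<Rightarrow> 'a \<Rightarrow> 'a" where
  "cs_diff S x y = cs_add S x (cs_scale S (- 1) y)"

locale cs_banach =
  fixes S :: "'a cspace"
  assumes zero_closed: "cs_zero S \<in> cs_carrier S"
    and add_closed: "\<lbrakk>x \<in> cs_carrier S; y \<in> cs_carrier S\<rbrakk> \<Longrightarrow> cs_add S x y \<in> cs_carrier S"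
    and scale_closed: "x \<in> cs_carrier S \<Longrightarrow> cs_scale S a x \<in> cs_carrier S"
    and add_assoc: "\<lbrakk>x \<in> cs_carrier S; y \<in> cs_carrier S; z \<in> cs_carrier S\<rbrakk>
      \<Longrightarrow> cs_add S (cs_add S x y) z = cs_add S x (cs_add S y z)"
    and add_commute: "\<lbrakk>x \<in> cs_carrier S; y \<in> cs_carrier S\<rbrakk> \<Longrightarrow> cs_add S x y = cs_add S y x"
    and add_zero: "x \<in> cs_carrier S \<Longrightarrow> cs_add S (cs_zero S) x = x"
    and add_inverse: "x \<in> cs_carrier S \<Longrightarrow> \<exists>y\<in>cs_carrier S. cs_add S x y = cs_zero S"
    and scale_add_right: "\<lbrakk>x \<in> cs_carrier S; y \<in> cs_carrier S\<rbrakk>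
      \<Longrightarrow> cs_scale S a (cs_add S x y) = cs_add S (cs_scale S a x) (cs_scale S a y)"
    and scale_add_left: "x \<in> cs_carrier S
      \<Longrightarrow> cs_scale S (a + b) x = cs_add S (cs_scale S a x) (cs_scale S b x)"
    and scale_scale: "x \<in> cs_carrier S \<Longrightarrow> cs_scale S a (cs_scale S b x) = cs_scale S (a * b) x"
    and scale_one: "x \<in> cs_carrier S \<Longrightarrow> cs_scale S 1 x = x"
    and norm_eq_zero: "x \<in> cs_carrier S \<Longrightarrow> cs_norm S x = 0 \<longleftrightarrow> x = cs_zero S"
    and norm_triangle: "\<lbrakk>x \<in> cs_carrier S; y \<in> cs_carrier S\<rbrakk>
      \<Longrightarrow> cs_norm S (cs_add S x y) \<le> cs_norm S x + cs_norm S y"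
    and norm_scale: "x \<in> cs_carrier S \<Longrightarrow> cs_norm S (cs_scale S a x) = cmod a * cs_norm S x"
    and complete: "\<lbrakk>\<And>n. u n \<in> cs_carrier S;
        \<forall>e>0. \<exists>N. \<forall>m\<ge>N. \<forall>n\<ge>N. cs_norm S (cs_diff S (u m) (u n)) < e\<rbrakk>
      \<Longrightarrow> \<exists>l\<in>cs_carrier S. (\<lambda>n. cs_norm S (cs_diff S (u n) l)) \<longlonglongrightarrow> 0"

definition cs_separable :: "'a cspace \<Rightarrow> bool" where
  "cs_separable S \<longleftrightarrow> (\<exists>D. countable D \<and> D \<subseteq> cs_carrier S \<and>
     (\<forall>x\<in>cs_carrier S. \<forall>e>0. \<exists>d\<in>D. cs_norm S (cs_diff S x d) < e))"

definition space_of_type :: "'a::complex_banach cspace" where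
  "space_of_type = \<lparr>cs_carrier = UNIV, cs_zero = 0, cs_add = (+), cs_scale = scaleC, cs_norm = norm\<rparr>"


section \<open>Semigroups of operators\<close>

definition cs_bounded_operator :: "'a cspace \<Rightarrow> ('a \<Rightarrow> 'a) \<Rightarrow> bool" where
  "cs_bounded_operator S f \<longleftrightarrow>
     (\<forall>x\<in>cs_carrier S. f x \<in> cs_carrier S) \<and>
     (\<forall>x\<in>cs_carrier S. \<forall>y\<in>cs_carrier S. f (cs_add S x y) = cs_add S (f x) (f y)) \<and>
     (\<forall>a. \<forall>x\<in>cs_carrier S. f (cs_scale S a x) = cs_scale S a (f x)) \<and>
     (\<exists>K. \<forall>x\<in>cs_carrier S. cs_norm S (f x) \<le> K * cs_norm S x)"

definition cs_opnorm :: "'a cspace \<Rightarrow> ('a \<Rightarrow> 'a) \<Rightarrow> real" where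
  "cs_opnorm S f = (SUP x\<in>{x \<in> cs_carrier S. cs_norm S x \<le> 1}. cs_norm S (f x))"

text \<open>The values of \<open>T\<close> at negative arguments are irrelevant.\<close>

definition c0_semigroup :: "'a cspace \<Rightarrow> (real \<Rightarrow> 'a \<Rightarrow> 'a) \<Rightarrow> bool" where
  "c0_semigroup S T \<longleftrightarrow>
     (\<forall>t\<ge>0. cs_bounded_operator S (T t)) \<and>
     (\<forall>x\<in>cs_carrier S. T 0 x = x) \<and>
     (\<forall>s\<ge>0. \<forall>t\<ge>0. \<forall>x\<in>cs_carrier S. T (s + t) x = T s (T t x)) \<and>
     (\<forall>x\<in>cs_carrier S. \<forall>s\<ge>0.
        ((\<lambda>t. cs_norm S (cs_diff S (T t x) (T s x))) \<longlongrightarrow> 0) (at s within {0..}))"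

text \<open>The infinitesimal generator is an unbounded operator, given here by its graph.\<close>

definition generator :: "'a cspace \<Rightarrow> (real \<Rightarrow> 'a \<Rightarrow> 'a) \<Rightarrow> ('a \<times> 'a) set" where
  "generator S T = {(x, y). x \<in> cs_carrier S \<and> y \<in> cs_carrier S \<and>
     ((\<lambda>h. cs_norm S (cs_diff S (cs_scale S (complex_of_real (1 / h)) (cs_diff S (T h x) x)) y))
        \<longlongrightarrow> 0) (at_right 0)}"

definition point_spectrum :: "'a cspace \<Rightarrow> ('a \<times> 'a) set \<Rightarrow> complex set" where
  "point_spectrum S A =
     {z. \<exists>x\<in>cs_carrier S. x \<noteq> cs_zero S \<and> (x, cs_scale S z x) \<in> A}"

definition partially_bounded :: "'a cspace \<Rightarrow> (nat \<Rightarrow> real) \<Rightarrow> (real \<Rightarrow> 'a \<Rightarrow> 'a) \<Rightarrow> bool" where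
  "partially_bounded S t T \<longleftrightarrow> bdd_above (range (\<lambda>k. cs_opnorm S (T (t k))))"

definition imaginary_point_spectrum :: "'a cspace \<Rightarrow> (real \<Rightarrow> 'a \<Rightarrow> 'a) \<Rightarrow> complex set" where
  "imaginary_point_spectrum S T = point_spectrum S (generator S T) \<inter> {z. Re z = 0}"


section \<open>Jamison sequences\<close>

definition admissible_sequence :: "(nat \<Rightarrow> real) \<Rightarrow> bool" where
  "admissible_sequence t \<longleftrightarrow> (\<forall>k. 0 < t k) \<and> incseq t \<and> filterlim t at_top sequentially"

text \<open>
  A separable Banach space has at most continuum many points, so up to isomorphism its carrier is
  a set of reals. Hence the quantification over all spaces carried by sets of reals is a
  quantification over all separable complex Banach spaces; \<open>jamison_sequenceD\<close> below proves that
  the definition yields the defining property for spaces carried by an arbitrary type.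
\<close>

definition jamison_sequence :: "(nat \<Rightarrow> real) \<Rightarrow> bool" where
  "jamison_sequence t \<longleftrightarrow> admissible_sequence t \<and>
     (\<forall>(Y :: real cspace) T. cs_banach Y \<and> cs_separable Y \<and> c0_semigroup Y T \<and>
        partially_bounded Y t T \<longrightarrow> countable (imaginary_point_spectrum Y T))"

definition infinite_dimensional :: "'a::complex_banach itself \<Rightarrow> bool" where
  "infinite_dimensional _ \<longleftrightarrow>
     \<not> (\<exists>B :: 'a set. finite B \<and> module.span scaleC B = UNIV)"

definition universal_jamison_space :: "'a::complex_banach itself \<Rightarrow> bool" where
  "universal_jamison_space _ \<longleftrightarrow>
     separable_space (euclidean :: 'a topology) \<and>
     infinite_dimensional TYPE('a) \<and>
     (\<forall>t. admissible_sequence t \<and> \<not> jamison_sequence t \<longrightarrow>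
        (\<exists>T. c0_semigroup (space_of_type :: 'a cspace) T \<and>
             partially_bounded (space_of_type :: 'a cspace) t T \<and>
             uncountable (imaginary_point_spectrum (space_of_type :: 'a cspace) T)))"

text \<open>
  The summands are indexed from \<open>0\<close>. The relation \<open>has_sum\<close> over \<open>UNIV\<close>, convergence along the
  net of finite partial sums, is unconditional convergence.
\<close>

definition unconditional_schauder_decomposition :: "(nat \<Rightarrow> 'a::complex_banach set) \<Rightarrow> bool" where
  "unconditional_schauder_decomposition E \<longleftrightarrow>
     (\<forall>l. module.subspace scaleC (E l) \<and> closed (E l) \<and> E l \<noteq> {0}) \<and>
     (\<forall>x. \<exists>!u. (\<forall>l. u l \<in> E l) \<and> (u has_sum x) UNIV)"


section \<open>Consistency of the two presentations of Banach spaces\<close>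

lemma scaleC_one: "scaleC 1 (x :: 'a::complex_banach) = x"
  using scaleC_of_real[of 1 x] by simp

lemma scaleC_minus_one: "scaleC (- 1) (x :: 'a::complex_banach) = - x"
  using scaleC_of_real[of "- 1" x] by simp

lemma module_scaleC: "module (scaleC :: complex \<Rightarrow> 'a \<Rightarrow> 'a::complex_banach)"
  by unfold_locales (simp_all add: scaleC_add_right scaleC_add_left scaleC_scaleC scaleC_one)

lemma space_of_type_simps [simp]:
  "cs_carrier (space_of_type :: 'a::complex_banach cspace) = UNIV"
  "cs_zero (space_of_type :: 'a cspace) = 0"
  "cs_add (space_of_type :: 'a cspace) = (+)"
  "cs_scale (space_of_type :: 'a cspace) = scaleC"
  "cs_norm (space_of_type :: 'a cspace) = norm"
  "cs_diff (space_of_type :: 'a cspace) x y = x - y"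
  by (simp_all add: space_of_type_def cs_diff_def scaleC_minus_one)

lemma cs_banach_space_of_type: "cs_banach (space_of_type :: 'a::complex_banach cspace)"
proof
  fix u :: "nat \<Rightarrow> 'a"
  assume "\<forall>e>0. \<exists>N. \<forall>m\<ge>N. \<forall>n\<ge>N.
    cs_norm space_of_type (cs_diff space_of_type (u m) (u n)) < e"
  then have "Cauchy u"
    by (simp add: Cauchy_def dist_norm)
  then obtain l where "u \<longlonglongrightarrow> l"
    using Cauchy_convergent convergent_def by blast
  then have "(\<lambda>n. norm (u n - l)) \<longlonglongrightarrow> 0"
    by (simp add: LIM_zero_iff tendsto_norm_zero)
  then show "\<exists>l\<in>cs_carrier space_of_type.
      (\<lambda>n. cs_norm space_of_type (cs_diff space_of_type (u n) l)) \<longlonglongrightarrow> 0"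
    by auto
next
  fix x :: 'a
  show "\<exists>y\<in>cs_carrier space_of_type. cs_add space_of_type x y = cs_zero space_of_type"
    by (auto intro: exI[of _ "- x"])
qed (auto simp: add.assoc add.commute scaleC_add_right scaleC_add_left scaleC_scaleC scaleC_one
       norm_scaleC norm_triangle_ineq)


context cs_banach
begin

lemma diff_closed: "\<lbrakk>x \<in> cs_carrier S; y \<in> cs_carrier S\<rbrakk> \<Longrightarrow> cs_diff S x y \<in> cs_carrier S"
  by (simp add: cs_diff_def add_closed scale_closed)

lemma scale_zero:
  assumes x: "x \<in> cs_carrier S"
  shows "cs_scale S 0 x = cs_zero S"
proof -
  have "cs_norm S (cs_scale S 0 x) = 0"
    using norm_scale[OF x, of 0] by simp
  then show ?thesis
    using norm_eq_zero scale_closed x by blast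
qed

lemma add_scale_minus_one:
  assumes x: "x \<in> cs_carrier S"
  shows "cs_add S x (cs_scale S (- 1) x) = cs_zero S"
  using scale_add_left[OF x, of 1 "- 1"] scale_zero[OF x] scale_one[OF x] by simp

lemma norm_nonneg:
  assumes x: "x \<in> cs_carrier S"
  shows "0 \<le> cs_norm S x"
proof -
  have "cs_norm S (cs_zero S) = 0"
    using norm_eq_zero zero_closed by blast
  then show ?thesis
    using norm_triangle[OF x scale_closed[OF x, of "- 1"]] norm_scale[OF x, of "- 1"]
      add_scale_minus_one[OF x] by simp
qed

lemma diff_add_diff:
  assumes x: "x \<in> cs_carrier S" and y: "y \<in> cs_carrier S" and z: "z \<in> cs_carrier S"
  shows "cs_add S (cs_diff S x y) (cs_diff S y z) = cs_diff S x z"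
proof -
  let ?n = "cs_scale S (- 1)"
  have c: "?n y \<in> cs_carrier S" "?n z \<in> cs_carrier S"
    using y z scale_closed by auto
  have "cs_add S (?n y) (cs_add S y (?n z)) = cs_add S (cs_add S y (?n y)) (?n z)"
    using add_assoc[OF c(1) y c(2)] add_commute[OF c(1) y] by simp
  also have "\<dots> = ?n z"
    using add_scale_minus_one[OF y] add_zero[OF c(2)] by simp
  finally show ?thesis
    unfolding cs_diff_def using add_assoc[OF x c(1) add_closed[OF y c(2)]] by simp
qed

lemma norm_diff_commute:
  assumes x: "x \<in> cs_carrier S" and y: "y \<in> cs_carrier S"
  shows "cs_norm S (cs_diff S x y) = cs_norm S (cs_diff S y x)"
proof -
  have "cs_scale S (- 1) (cs_diff S x y) = cs_diff S y x"
    unfolding cs_diff_def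
    using scale_add_right[OF x scale_closed[OF y, of "- 1"], of "- 1"] scale_scale[OF y, of "- 1" "- 1"]
      scale_one[OF y] add_commute[OF scale_closed[OF x, of "- 1"] y] by simp
  then show ?thesis
    using norm_scale[OF diff_closed[OF x y], of "- 1"] by simp
qed

lemma norm_diff_triangle:
  assumes "x \<in> cs_carrier S" "y \<in> cs_carrier S" "z \<in> cs_carrier S"
  shows "cs_norm S (cs_diff S x z) \<le> cs_norm S (cs_diff S x y) + cs_norm S (cs_diff S y z)"
  using norm_triangle[OF diff_closed diff_closed, of x y y z] diff_add_diff assms by simp

lemma norm_diff_eq_zero:
  assumes x: "x \<in> cs_carrier S" and y: "y \<in> cs_carrier S"
    and "cs_norm S (cs_diff S x y) = 0"
  shows "x = y"
proof -
  have d: "cs_diff S x y = cs_zero S"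
    using norm_eq_zero[OF diff_closed[OF x y]] assms by simp
  have n: "cs_scale S (- 1) y \<in> cs_carrier S"
    using scale_closed y by simp
  have "x = cs_add S x (cs_add S y (cs_scale S (- 1) y))"
    using add_scale_minus_one[OF y] add_zero[OF x] add_commute[OF x zero_closed] by simp
  also have "\<dots> = cs_add S (cs_diff S x y) y"
    unfolding cs_diff_def using add_assoc[OF x n y] add_commute[OF n y] by simp
  also have "\<dots> = y"
    using d add_zero[OF y] by simp
  finally show ?thesis .
qed

lemma inj_into_reals:
  assumes "cs_separable S"
  shows "\<exists>f :: 'a \<Rightarrow> real. inj_on f (cs_carrier S)"
proof -
  obtain D where D: "countable D" "D \<subseteq> cs_carrier S"
    and dense: "\<And>x e. \<lbrakk>x \<in> cs_carrier S; e > 0\<rbrakk> \<Longrightarrow> \<exists>d\<in>D. cs_norm S (cs_diff S x d) < e"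
    using assms unfolding cs_separable_def by blast
  define ball where "ball = (\<lambda>x. {k. case prod_decode k of (i, m) \<Rightarrow>
    cs_norm S (cs_diff S x (from_nat_into D i)) < 1 / real (Suc m)})"
  have "inj_on ball (cs_carrier S)"
  proof (rule inj_onI, rule ccontr)
    fix x y
    assume x: "x \<in> cs_carrier S" and y: "y \<in> cs_carrier S" and eq: "ball x = ball y" and "x \<noteq> y"
    then have "cs_norm S (cs_diff S x y) > 0"
      using norm_diff_eq_zero[OF x y] norm_nonneg[OF diff_closed[OF x y]] by fastforce
    then obtain m where m: "1 / real (Suc m) < cs_norm S (cs_diff S x y) / 2"
      using nat_approx_posE half_gt_zero by blast
    obtain d where d: "d \<in> D" "cs_norm S (cs_diff S x d) < 1 / real (Suc m)"
      using dense[OF x, of "1 / real (Suc m)"] by auto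
    obtain i where i: "from_nat_into D i = d"
      using from_nat_into_surj[OF D(1) d(1)] by blast
    have "prod_encode (i, m) \<in> ball x"
      using d i by (simp add: ball_def)
    then have "cs_norm S (cs_diff S y d) < 1 / real (Suc m)"
      unfolding eq using i by (simp add: ball_def)
    then show False
      using norm_diff_triangle[OF x _ y, of d] norm_diff_commute[OF y, of d] d D m by auto
  qed
  moreover obtain h :: "nat set \<Rightarrow> real" where "inj h"
    using nat_sets_eqpoll_reals unfolding eqpoll_def bij_betw_def by blast
  ultimately have "inj_on (h \<circ> ball) (cs_carrier S)"
    by (meson comp_inj_on inj_on_subset subset_UNIV)
  then show ?thesis by blast
qed

end

definition transport :: "('a \<Rightarrow> 'b) \<Rightarrow> 'a cspace \<Rightarrow> 'b cspace" where
  "transport f S = (let g = inv_into (cs_carrier S) f in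
     \<lparr>cs_carrier = f ` cs_carrier S, cs_zero = f (cs_zero S),
      cs_add = (\<lambda>a b. f (cs_add S (g a) (g b))), cs_scale = (\<lambda>c a. f (cs_scale S c (g a))),
      cs_norm = (\<lambda>a. cs_norm S (g a))\<rparr>)"

theorem jamison_sequenceD:
  fixes S :: "'a cspace"
  assumes t: "jamison_sequence t"
    and S: "cs_banach S" and sep: "cs_separable S"
    and T: "c0_semigroup S T" and bdd: "partially_bounded S t T"
  shows "countable (imaginary_point_spectrum S T)"
proof -
  interpret S: cs_banach S by (rule S)
  obtain f :: "'a \<Rightarrow> real" where f: "inj_on f (cs_carrier S)"
    using S.inj_into_reals[OF sep] by blast
  define Y where "Y = transport f S"
  define g where "g = inv_into (cs_carrier S) f"
  have gf [simp]: "g (f x) = x" if "x \<in> cs_carrier S" for x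
    using f that by (simp add: g_def)
  have Y [simp]: "cs_carrier Y = f ` cs_carrier S" "cs_zero Y = f (cs_zero S)"
    "cs_add Y a b = f (cs_add S (g a) (g b))" "cs_scale Y c a = f (cs_scale S c (g a))"
    "cs_norm Y a = cs_norm S (g a)" for a b c
    by (simp_all add: Y_def transport_def g_def Let_def)
  note closed [simp] = S.zero_closed S.add_closed S.scale_closed S.diff_closed
  have diff [simp]: "cs_diff Y (f x) (f y) = f (cs_diff S x y)"
    if "x \<in> cs_carrier S" "y \<in> cs_carrier S" for x y
    using that by (simp add: cs_diff_def)
  have f_eq [simp]: "f x = f y \<longleftrightarrow> x = y" if "x \<in> cs_carrier S" "y \<in> cs_carrier S" for x y
    using f that by (auto dest: inj_onD)
  define U where "U = (\<lambda>t a. f (T t (g a)))"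
  have Uf [simp]: "U t (f x) = f (T t x)" if "x \<in> cs_carrier S" for t x
    using that by (simp add: U_def)
  have T_closed [simp]: "T t x \<in> cs_carrier S" if "t \<ge> 0" "x \<in> cs_carrier S" for t x
    using T that by (auto simp: c0_semigroup_def cs_bounded_operator_def)
  have "cs_banach Y"
  proof
    fix u :: "nat \<Rightarrow> real"
    assume u: "\<And>n. u n \<in> cs_carrier Y"
      and c: "\<forall>e>0. \<exists>N. \<forall>m\<ge>N. \<forall>n\<ge>N. cs_norm Y (cs_diff Y (u m) (u n)) < e"
    define v where "v = (\<lambda>n. g (u n))"
    have v [simp]: "v n \<in> cs_carrier S" for n
      using u[of n] by (auto simp: v_def)
    have uv: "u = (\<lambda>n. f (v n))"
    proof
      show "u n = f (v n)" for n
        using u[of n] by (auto simp: v_def)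
    qed
    obtain l where "l \<in> cs_carrier S" "(\<lambda>n. cs_norm S (cs_diff S (v n) l)) \<longlonglongrightarrow> 0"
      using S.complete[of v] c by (auto simp: uv)
    then show "\<exists>l\<in>cs_carrier Y. (\<lambda>n. cs_norm Y (cs_diff Y (u n) l)) \<longlonglongrightarrow> 0"
      by (auto simp: uv)
  next
    fix x assume "x \<in> cs_carrier Y"
    then show "\<exists>y\<in>cs_carrier Y. cs_add Y x y = cs_zero Y"
      using S.add_inverse by fastforce
  next
    fix x y assume "x \<in> cs_carrier Y" "y \<in> cs_carrier Y"
    then show "cs_add Y x y = cs_add Y y x"
      using S.add_commute by fastforce
  qed (auto simp: S.add_assoc S.add_zero S.scale_add_right S.scale_add_left
         S.scale_scale S.scale_one S.norm_eq_zero S.norm_triangle S.norm_scale)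
  moreover have "cs_separable Y"
  proof -
    obtain D where D: "countable D" "D \<subseteq> cs_carrier S"
      "\<forall>x\<in>cs_carrier S. \<forall>e>0. \<exists>d\<in>D. cs_norm S (cs_diff S x d) < e"
      using sep unfolding cs_separable_def by blast
    have "\<exists>d\<in>f ` D. cs_norm Y (cs_diff Y x d) < e" if xe: "x \<in> cs_carrier Y" "e > 0" for x e
    proof -
      obtain z where z: "z \<in> cs_carrier S" "x = f z"
        using xe by auto
      then obtain d where "d \<in> D" "cs_norm S (cs_diff S z d) < e"
        using D(3) xe by blast
      then show ?thesis
        using z D(2) by (intro bexI[of _ "f d"]) auto
    qed
    then show ?thesis
      unfolding cs_separable_def using D by (intro exI[of _ "f ` D"]) auto
  qed
  moreover have "c0_semigroup Y U"
    unfolding c0_semigroup_def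
  proof (intro conjI ballI allI impI)
    fix t :: real assume t: "0 \<le> t"
    have "cs_bounded_operator S (T t)"
      using T t by (simp add: c0_semigroup_def)
    then show "cs_bounded_operator Y (U t)"
      using t by (auto simp: cs_bounded_operator_def)
  next
    fix x assume "x \<in> cs_carrier Y"
    then show "U 0 x = x"
      using T by (auto simp: c0_semigroup_def)
  next
    fix s t :: real and x assume "0 \<le> s" "0 \<le> t" "x \<in> cs_carrier Y"
    then show "U (s + t) x = U s (U t x)"
      using T by (auto simp: c0_semigroup_def)
  next
    fix x and s :: real assume "x \<in> cs_carrier Y" and s: "0 \<le> s"
    then obtain z where z: "z \<in> cs_carrier S" "x = f z" by auto
    have "((\<lambda>t. cs_norm S (cs_diff S (T t z) (T s z))) \<longlongrightarrow> 0) (at s within {0..})"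
      using T s z by (simp add: c0_semigroup_def)
    moreover have "\<forall>\<^sub>F t in at s within {0..}.
        cs_norm S (cs_diff S (T t z) (T s z)) = cs_norm Y (cs_diff Y (U t x) (U s x))"
      using z s by (auto simp: eventually_at_filter)
    ultimately show "((\<lambda>t. cs_norm Y (cs_diff Y (U t x) (U s x))) \<longlongrightarrow> 0) (at s within {0..})"
      by (rule Lim_transform_eventually)
  qed
  moreover have "partially_bounded Y t U"
  proof -
    have "t k > 0" for k
      using t by (simp add: jamison_sequence_def admissible_sequence_def)
    then have "cs_opnorm Y (U (t k)) = cs_opnorm S (T (t k))" for k
    proof -
      have "{x \<in> cs_carrier Y. cs_norm Y x \<le> 1} = f ` {x \<in> cs_carrier S. cs_norm S x \<le> 1}"
        by auto
      moreover have "cs_norm Y (U (t k) (f x)) = cs_norm S (T (t k) x)" if "x \<in> cs_carrier S" for x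
        using that \<open>t k > 0\<close> by simp
      ultimately show ?thesis
        by (simp add: cs_opnorm_def image_image del: Y)
    qed
    then show ?thesis
      using bdd by (simp add: partially_bounded_def)
  qed
  ultimately have "countable (imaginary_point_spectrum Y U)"
    using t by (auto simp: jamison_sequence_def)
  moreover have "imaginary_point_spectrum S T \<subseteq> imaginary_point_spectrum Y U"
  proof
    fix z assume "z \<in> imaginary_point_spectrum S T"
    then obtain x where x: "x \<in> cs_carrier S" "x \<noteq> cs_zero S" "(x, cs_scale S z x) \<in> generator S T"
      and z: "Re z = 0"
      by (auto simp: imaginary_point_spectrum_def point_spectrum_def)
    have "\<forall>\<^sub>F h in at_right 0.
        cs_norm S (cs_diff S (cs_scale S (complex_of_real (1 / h)) (cs_diff S (T h x) x)) (cs_scale S z x)) =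
        cs_norm Y (cs_diff Y (cs_scale Y (complex_of_real (1 / h)) (cs_diff Y (U h (f x)) (f x)))
          (cs_scale Y z (f x)))"
      using x(1) by (auto simp: eventually_at_filter)
    then have "(f x, cs_scale Y z (f x)) \<in> generator Y U"
      using x(1,3) Lim_transform_eventually by (fastforce simp: generator_def)
    then show "z \<in> imaginary_point_spectrum Y U"
      using x(1,2) z by (auto simp: imaginary_point_spectrum_def point_spectrum_def intro!: bexI[of _ x])
  qed
  ultimately show ?thesis
    using countable_subset by blast
qed

end

theory Submission
  imports Defs
begin

text \<open>
  Two facts are combined. The first concerns the sequence alone: if \<open>t\<close> is not a Jamison sequence,
  there are arbitrarily small \<open>\<theta> > 0\<close> for which \<open>cis (\<theta> * t k)\<close> is arbitrarily close to 1, uniformly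
  in \<open>k\<close>. Indeed some separable space carries a partially bounded semigroup with uncountably many
  imaginary eigenvalues; by separability two of its unit eigenvectors are as close as desired
  while their eigenvalues are close but different, and \<open>\<theta>\<close> is the difference of these eigenvalues
  (\<open>small_phase_if_not_jamison\<close>).

  The second fact is a construction on \<open>X\<close> out of a rapidly decreasing sequence of such numbers
  \<open>\<theta> b\<close>. The finite sets \<open>A\<close> of natural numbers form a tree in which the parent \<open>A'\<close> of \<open>A\<close> lacks the
  maximum \<open>m\<close> of \<open>A\<close>. To \<open>A\<close> belong the frequency \<open>\<lambda>\<^sub>A\<close>, the sum of \<open>\<theta>\<close> over \<open>A\<close>, and a unit vector
  \<open>e\<^sub>A\<close> in a summand of its own. Let \<open>u\<^sub>A = e\<^sub>A\<close> at the root, the empty set, and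
  \<open>u\<^sub>A = u\<^sub>A\<^sub>' + 2\<^sup>-\<^sup>m e\<^sub>A\<close> elsewhere. The requirement that \<open>T t\<close> multiply every
  \<open>u\<^sub>A\<close> by \<open>cis (\<lambda>\<^sub>A t)\<close> means that \<open>T t\<close> maps \<open>e\<^sub>A\<close> to \<open>cis (\<lambda>\<^sub>A t) e\<^sub>A\<close> plus \<open>2\<^sup>m u\<^sub>A\<^sub>'\<close> times the difference
  of the phases of \<open>A\<close> and \<open>A'\<close>. This is used as the definition: \<open>T t\<close> is a diagonal operator plus a
  series of operators of rank one. The diagonal part is bounded uniformly in \<open>t\<close> since the
  decomposition is unconditional (\<open>multiplier_bounded\<close>). In the series the difference of phases has
  modulus \<open>\<bar>cis (\<theta>\<^sub>m t) - 1\<bar>\<close>, and every other factor is independent of \<open>\<theta>\<close>. So the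
  series converges for every \<open>t\<close> if the \<open>\<theta> b\<close> are small enough, and its sum is bounded uniformly over
  the times \<open>t k\<close> if the \<open>cis (\<theta> b * t k)\<close> are close enough to 1.

  Along the initial segments \<open>A\<close> of any set \<open>B\<close> of natural numbers the vectors \<open>u\<^sub>A\<close> converge to an
  eigenvector of the generator, whose eigenvalue is \<open>\<i>\<close> times the sum of \<open>\<theta>\<close> over \<open>B\<close>
  (\<open>branch_eigenvector\<close>). Since each \<open>\<theta> b\<close> is at most a third of its predecessor, different sets \<open>B\<close>
  have different eigenvalues (\<open>inj_branch_frequency\<close>), and there are uncountably many sets \<open>B\<close>.

  The coordinates on the lines spanned by the \<open>e\<^sub>A\<close> come from the Hahn-Banach theorem, and the uniform
  bounds for the partial sums of the decomposition from Baire's theorem.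
\<close>

section \<open>Complex scalars and phases\<close>

lemma bounded_bilinear_scaleC:
  "bounded_bilinear (scaleC :: complex \<Rightarrow> 'a \<Rightarrow> 'a::complex_banach)"
proof
  show "\<exists>K. \<forall>a b. norm (scaleC a (b :: 'a)) \<le> norm a * norm b * K"
    by (rule exI[of _ 1]) (simp add: norm_scaleC)
qed (simp_all add: scaleC_add_left scaleC_add_right scaleC_scaleC flip: scaleC_of_real,
     simp_all add: mult.commute scaleR_conv_of_real scaleC_scaleC)

lemma exp_difference_quotient:
  fixes z :: complex
  shows "((\<lambda>h. (exp (z * of_real h) - 1) / of_real h) \<longlongrightarrow> z) (at_right 0)"
proof -
  have "((\<lambda>w. exp (z * w)) has_field_derivative z) (at 0)"
    by (auto intro!: derivative_eq_intros)
  then have "((\<lambda>w. (exp (z * w) - 1) / w) \<longlongrightarrow> z) (at 0)"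
    by (simp add: DERIV_def)
  moreover have "filterlim complex_of_real (at 0) (at_right 0)"
    by (intro filterlim_atI tendsto_eq_intros) (auto simp: eventually_at_filter)
  ultimately show ?thesis
    by (rule filterlim_compose)
qed

lemma norm_cis_minus_one_le: "cmod (cis a - 1) \<le> \<bar>a\<bar>"
  using dist_exp_i_1[of a] abs_sin_x_le_abs_x[of "a / 2"]
  by (simp add: cis_conv_exp mult.commute)

interpretation scaleC: bounded_bilinear "scaleC :: complex \<Rightarrow> 'a \<Rightarrow> 'a::complex_banach"
  by (rule bounded_bilinear_scaleC)

section \<open>Continuous linear functionals\<close>

definition sublinear :: "('a::real_vector \<Rightarrow> real) \<Rightarrow> bool" where
  "sublinear q \<longleftrightarrow> (\<forall>x y. q (x + y) \<le> q x + q y) \<and> (\<forall>c\<ge>0. \<forall>x. q (c *\<^sub>R x) \<le> c * q x)"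

lemma sublinear_add: "sublinear q \<Longrightarrow> q (x + y) \<le> q x + q y"
  and sublinear_scale_le: "sublinear q \<Longrightarrow> c \<ge> 0 \<Longrightarrow> q (c *\<^sub>R x) \<le> c * q x"
  by (auto simp: sublinear_def)

lemma sublinear_zero: "sublinear q \<Longrightarrow> q 0 = 0"
  using sublinear_scale_le[of q 0 0] sublinear_add[of q 0 0] by simp

lemma sublinear_neg: "sublinear q \<Longrightarrow> - q (- x) \<le> q x"
  using sublinear_add[of q x "- x"] sublinear_zero[of q] by simp

lemma sublinear_scale:
  assumes q: "sublinear q" and c: "c \<ge> 0"
  shows "q (c *\<^sub>R x) = c * q x"
proof (cases "c = 0")
  case False
  then have c: "c > 0" using c by simp
  have "q x \<le> inverse c * q (c *\<^sub>R x)"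
    using sublinear_scale_le[OF q, of "inverse c" "c *\<^sub>R x"] c by simp
  then have "c * q x \<le> q (c *\<^sub>R x)"
    using c by (simp add: field_simps)
  then show ?thesis
    using sublinear_scale_le[OF q, of c x] c by simp
qed (simp add: sublinear_zero[OF q])

text \<open>
  Lowering \<open>q\<close> in the direction \<open>y\<close>: the result is sublinear and below \<open>q\<close>, and its value at \<open>- y\<close>
  is at most \<open>- q y\<close>. A sublinear functional that no lowering changes is therefore odd, and an odd
  sublinear functional is linear. This is how linear functionals arise below.
\<close>

definition descend :: "('a::real_vector \<Rightarrow> real) \<Rightarrow> 'a \<Rightarrow> 'a \<Rightarrow> real" where
  "descend q y x = (INF t\<in>{0..}. q (x + t *\<^sub>R y) - t * q y)"

lemma descend_lower:
  assumes q: "sublinear q" and t: "t \<ge> 0"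
  shows "- q (- x) \<le> q (x + t *\<^sub>R y) - t * q y"
  using sublinear_add[OF q, of "x + t *\<^sub>R y" "- x"] sublinear_scale[OF q t, of y] by simp

lemma descend_le:
  assumes q: "sublinear q" and t: "t \<ge> 0"
  shows "descend q y x \<le> q (x + t *\<^sub>R y) - t * q y"
  unfolding descend_def
  by (rule cINF_lower) (use descend_lower[OF q] t in \<open>auto intro!: bdd_belowI2\<close>)

lemma descend_greatest:
  assumes "\<And>t. t \<ge> 0 \<Longrightarrow> m \<le> q (x + t *\<^sub>R y) - t * q y"
  shows "m \<le> descend q y x"
  unfolding descend_def by (rule cINF_greatest) (use assms in auto)

lemma sublinear_descend:
  assumes q: "sublinear q"
  shows "sublinear (descend q y)"
  unfolding sublinear_def
proof (intro conjI allI impI)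
  fix a b
  have "descend q y (a + b) - descend q y b \<le> q (a + s *\<^sub>R y) - s * q y" if s: "s \<ge> 0" for s
  proof -
    have "descend q y (a + b) - (q (a + s *\<^sub>R y) - s * q y) \<le> q (b + t *\<^sub>R y) - t * q y"
      if t: "t \<ge> 0" for t
    proof -
      have "descend q y (a + b) \<le> q ((a + s *\<^sub>R y) + (b + t *\<^sub>R y)) - (s + t) * q y"
        using descend_le[OF q, of "s + t" y "a + b"] s t by (simp add: algebra_simps)
      then show ?thesis
        using sublinear_add[OF q, of "a + s *\<^sub>R y" "b + t *\<^sub>R y"] by (simp add: algebra_simps)
    qed
    from descend_greatest[OF this] show ?thesis by simp
  qed
  from descend_greatest[OF this] show "descend q y (a + b) \<le> descend q y a + descend q y b"
    by simp
next
  fix c :: real and x assume c: "c \<ge> 0"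
  show "descend q y (c *\<^sub>R x) \<le> c * descend q y x"
  proof (cases "c = 0")
    case True
    then show ?thesis
      using descend_le[OF q, of 0 y 0] sublinear_zero[OF q] by simp
  next
    case False
    then have c: "c > 0" using c by simp
    have "descend q y (c *\<^sub>R x) / c \<le> q (x + t *\<^sub>R y) - t * q y" if t: "t \<ge> 0" for t
    proof -
      have "descend q y (c *\<^sub>R x) \<le> q (c *\<^sub>R (x + t *\<^sub>R y)) - (c * t) * q y"
        using descend_le[OF q, of "c * t" y "c *\<^sub>R x"] c t by (simp add: algebra_simps)
      then show ?thesis
        using sublinear_scale[OF q, of c "x + t *\<^sub>R y"] c by (simp add: field_simps)
    qed
    from descend_greatest[OF this] show ?thesis
      using c by (simp add: field_simps)
  qed
qed

text \<open>
  Zorn's lemma applies because the pointwise infimum of a chain is again sublinear. For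
  subadditivity the chain condition matters: of two members one is the smaller at both points, and
  its own subadditivity bounds the infimum at the sum.
\<close>

lemma minimal_sublinear_below:
  fixes p :: "'a::real_vector \<Rightarrow> real"
  assumes p: "sublinear p"
  obtains m where "sublinear m" "\<And>x. m x \<le> p x"
    "\<And>q. sublinear q \<Longrightarrow> (\<And>x. q x \<le> m x) \<Longrightarrow> q = m"
proof -
  define A where "A = {q. sublinear q \<and> q \<le> p}"
  have "\<exists>m\<in>A. \<forall>q\<in>A. q \<le> m \<longrightarrow> q = m"
  proof (rule predicate_Zorn)
    show "partial_order_on A (relation_of (\<lambda>q r. r \<le> q) A)"
      by (rule partial_order_on_relation_ofI) auto
  next
    fix C assume C: "C \<in> Chains (relation_of (\<lambda>q r. r \<le> q) A)"
    then have sub: "sublinear q" "q x \<le> p x" if "q \<in> C" for q x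
      using that by (auto simp: Chains_def relation_of_def A_def le_fun_def)
    have lin: "q \<le> r \<or> r \<le> q" if "q \<in> C" "r \<in> C" for q r
      using C that by (auto simp: Chains_def relation_of_def)
    show "\<exists>u\<in>A. \<forall>a\<in>C. u \<le> a"
    proof (cases "C = {}")
      case True
      then show ?thesis using p by (auto simp: A_def)
    next
      case False
      define u where "u = (\<lambda>x. INF q\<in>C. q x)"
      have "- p (- x) \<le> q x" if "q \<in> C" for q x
        using sub(2)[OF that, of "- x"] sub(1)[OF that] sublinear_neg[of q x] by linarith
      then have le: "u x \<le> q x" if "q \<in> C" for q x
        unfolding u_def by (intro cINF_lower) (use that in \<open>auto intro!: bdd_belowI2\<close>)
      have gr: "m \<le> u x" if "\<And>q. q \<in> C \<Longrightarrow> m \<le> q x" for m x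
        unfolding u_def by (rule cINF_greatest) (use that False in auto)
      have "sublinear u"
        unfolding sublinear_def
      proof (intro conjI allI impI)
        fix x y
        have "u (x + y) - u y \<le> q x" if q: "q \<in> C" for q
        proof -
          have "u (x + y) - q x \<le> r y" if r: "r \<in> C" for r
          proof (cases "q \<le> r")
            case True
            then show ?thesis
              using sublinear_add[OF sub(1)[OF q], of x y] le[OF q, of "x + y"]
              by (auto simp: le_fun_def dest!: spec[of _ y])
          next
            case False
            then have "r x \<le> q x" using lin[OF q r] by (auto simp: le_fun_def)
            then show ?thesis
              using sublinear_add[OF sub(1)[OF r], of x y] le[OF r, of "x + y"] by linarith
          qed
          then have "u (x + y) - q x \<le> u y" by (rule gr)
          then show ?thesis by simp
        qed
        then have "u (x + y) - u y \<le> u x" by (rule gr)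
        then show "u (x + y) \<le> u x + u y" by simp
      next
        fix c :: real and x assume c: "c \<ge> 0"
        show "u (c *\<^sub>R x) \<le> c * u x"
        proof (cases "c = 0")
          case True
          then show ?thesis
            using \<open>C \<noteq> {}\<close> le[of _ 0] sublinear_zero[OF sub(1)] by fastforce
        next
          case False
          then have c: "c > 0" using c by simp
          have "u (c *\<^sub>R x) / c \<le> q x" if "q \<in> C" for q
            using le[OF that, of "c *\<^sub>R x"] sublinear_scale[OF sub(1)[OF that], of c x] c
            by (simp add: field_simps)
          then have "u (c *\<^sub>R x) / c \<le> u x" by (rule gr)
          then show ?thesis
            using c by (simp add: field_simps)
        qed
      qed
      moreover have "u x \<le> p x" for x
        using False le sub(2) by (meson all_not_in_conv order_trans)
      ultimately show ?thesis
        using le by (auto simp: A_def le_fun_def)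
    qed
  qed
  then obtain m where m: "m \<in> A" "\<And>q. q \<in> A \<Longrightarrow> q \<le> m \<Longrightarrow> q = m"
    by blast
  then have m': "sublinear m" "\<And>x. m x \<le> p x"
    by (auto simp: A_def le_fun_def)
  show thesis
  proof (rule that[OF m'])
    fix q assume q: "sublinear q" "\<And>x. q x \<le> m x"
    then have "q x \<le> p x" for x
      using m'(2)[of x] order_trans by blast
    then show "q = m"
      using q by (intro m(2)) (auto simp: A_def le_fun_def)
  qed
qed

text \<open>
  The Hahn-Banach theorem in the form needed for coordinates. Minimising below \<open>descend norm e\<close>
  instead of \<open>norm\<close> forces the value at \<open>- e\<close> down to \<open>- norm e\<close>, so that the linear functional
  attains the norm at \<open>e\<close>.
\<close>

lemma linear_functional_norming:
  fixes e :: "'a::real_normed_vector"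
  obtains f :: "'a \<Rightarrow> real" where "bounded_linear f" "f e = norm e"
proof -
  have norm: "sublinear (norm :: 'a \<Rightarrow> real)"
    by (simp add: sublinear_def norm_triangle_ineq)
  obtain m where m: "sublinear m" "\<And>x. m x \<le> descend norm e x"
    and min: "\<And>q. sublinear q \<Longrightarrow> (\<And>x. q x \<le> m x) \<Longrightarrow> q = m"
    using minimal_sublinear_below[OF sublinear_descend[OF norm]] by metis
  have below: "m x \<le> norm x" for x
    using m(2)[of x] descend_le[OF norm, of 0 e x] by simp
  have odd: "m (- x) = - m x" for x
  proof -
    have "descend m x = m"
      by (rule min[OF sublinear_descend[OF m(1)]]) (use descend_le[OF m(1), of 0 x] in auto)
    then have "m (- x) \<le> - m x"
      using descend_le[OF m(1), of 1 x "- x"] sublinear_zero[OF m(1)] by simp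
    then show ?thesis
      using sublinear_neg[OF m(1), of x] by simp
  qed
  have add: "m (x + y) = m x + m y" for x y
    using sublinear_add[OF m(1), of x y] sublinear_add[OF m(1), of "- x" "- y"] odd[of x] odd[of y]
      odd[of "x + y"] by (simp add: algebra_simps)
  have scale: "m (c *\<^sub>R x) = c * m x" for c x
  proof (cases "c \<ge> 0")
    case False
    then have "m ((- c) *\<^sub>R x) = (- c) * m x"
      by (intro sublinear_scale[OF m(1)]) simp
    then show ?thesis
      using odd[of "c *\<^sub>R x"] by simp
  qed (rule sublinear_scale[OF m(1)])
  have "\<bar>m x\<bar> \<le> norm x" for x
    using below[of x] below[of "- x"] odd[of x] by (auto simp: abs_le_iff)
  then have "bounded_linear m"
    by (intro bounded_linear_intro[of m 1]) (auto simp: add scale)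
  moreover have "m e = norm e"
    using m(2)[of "- e"] descend_le[OF norm, of 1 e "- e"] odd[of e] below[of e] by simp
  ultimately show thesis ..
qed

lemma complex_functional_nonzero:
  fixes e :: "'a::complex_banach"
  assumes e: "e \<noteq> 0"
  obtains f :: "'a \<Rightarrow> complex"
  where "bounded_linear f" "\<And>c x. f (scaleC c x) = c * f x" "f e = 1"
proof -
  obtain g :: "'a \<Rightarrow> real" where g: "bounded_linear g" and ge: "g e = norm e"
    using linear_functional_norming by blast
  interpret g: bounded_linear g by (rule g)
  \<comment> \<open>the complex-linear functional whose real part is the real-linear functional \<open>g\<close>\<close>
  define f where "f = (\<lambda>x. complex_of_real (g x) - \<i> * complex_of_real (g (scaleC \<i> x)))"
  have f: "bounded_linear f"
    unfolding f_def
    by (intro bounded_linear_sub bounded_linear_const_mult bounded_linear_compose[OF bounded_linear_of_real]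
        g bounded_linear_compose[OF g scaleC.bounded_linear_right])
  have fc: "f (scaleC c x) = c * f x" for c x
  proof -
    have "scaleC c x = Re c *\<^sub>R x + Im c *\<^sub>R scaleC \<i> x" for x :: 'a
      by (subst complex_eq[of c])
         (simp add: scaleC_add_left scaleC_scaleC mult.commute flip: scaleC_of_real)
    then have G: "g (scaleC c x) = Re c * g x + Im c * g (scaleC \<i> x)" for x
      by (simp add: g.add g.scale)
    have "scaleC \<i> (scaleC \<i> x) = - x"
      using scaleC_minus_one[of x] by (simp add: scaleC_scaleC)
    moreover have "scaleC \<i> (scaleC c x) = scaleC c (scaleC \<i> x)"
      by (simp add: scaleC_scaleC mult.commute)
    ultimately show ?thesis
      by (simp add: f_def G g.neg complex_eq_iff)
  qed
  have ne: "f e \<noteq> 0"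
    using e by (simp add: f_def ge complex_eq_iff)
  show thesis
  proof (rule that[of "\<lambda>x. f x / f e"])
    show "bounded_linear (\<lambda>x. f x / f e)"
      by (intro bounded_linear_divide[THEN bounded_linear_compose] f)
  qed (use ne in \<open>auto simp: fc\<close>)
qed

section \<open>Unconditional Schauder decompositions\<close>

lemma dense_in_ball_of_countable_union:
  fixes A :: "nat \<Rightarrow> 'a::banach set"
  assumes A: "(\<Union>n. A n) = UNIV"
  obtains n a r where "r > 0" "ball a r \<subseteq> closure (A n)"
proof -
  have "\<exists>n. interior (closure (A n)) \<noteq> {}"
  proof (rule ccontr)
    assume "\<not> ?thesis"
    then have empty: "interior (closure (A n)) = {}" for n
      by blast
    have "Met_TC.mtopology interior_of \<Union>(range (\<lambda>n. closure (A n))) = {}"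
    proof (rule Met_TC.metric_Baire_category_alt)
      show "Met_TC.mcomplete TYPE('a)"
        by (simp add: mcomplete_iff_complete complete_UNIV)
    next
      fix T assume "T \<in> range (\<lambda>n. closure (A n))"
      then obtain n where T: "T = closure (A n)"
        by blast
      show "closedin Met_TC.mtopology T \<and> Met_TC.mtopology interior_of T = {}"
        unfolding T by (simp add: empty)
    qed simp
    then have "interior (\<Union>n. closure (A n)) = {}"
      by simp
    moreover have "(\<Union>n. closure (A n)) = UNIV"
      using A closure_subset by blast
    ultimately show False by simp
  qed
  then show thesis
    using that by (metis ex_in_conv mem_interior)
qed

text \<open>
  A sum with coefficients in the unit interval is a convex combination of the sums over subsets;
  the vector \<open>y\<close> carries the terms already treated in the induction.
\<close>

lemma norm_sum_convex_coefficients_le: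
  fixes u :: "'i \<Rightarrow> 'a::real_normed_vector" and a :: "'i \<Rightarrow> real"
  assumes "finite F" and "\<And>l. 0 \<le> a l \<and> a l \<le> 1"
    and "\<And>G. G \<subseteq> F \<Longrightarrow> norm (y + sum u G) \<le> B"
  shows "norm (y + (\<Sum>l\<in>F. a l *\<^sub>R u l)) \<le> B"
  using assms(1,3)
proof (induction F arbitrary: y rule: finite_induct)
  case (insert k F)
  let ?s = "\<Sum>l\<in>F. a l *\<^sub>R u l"
  have 1: "norm (y + ?s) \<le> B"
    by (rule insert.IH, rule insert.prems) auto
  have 2: "norm ((y + u k) + ?s) \<le> B"
  proof (rule insert.IH)
    fix G assume G: "G \<subseteq> F"
    then have "finite G" "k \<notin> G"
      using insert.hyps finite_subset by auto
    then show "norm ((y + u k) + sum u G) \<le> B"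
      using insert.prems[of "insert k G"] G by (auto simp: add.assoc)
  qed
  have "y + (\<Sum>l\<in>insert k F. a l *\<^sub>R u l) = (1 - a k) *\<^sub>R (y + ?s) + a k *\<^sub>R ((y + u k) + ?s)"
    using insert.hyps by (simp add: algebra_simps)
  then have "norm (y + (\<Sum>l\<in>insert k F. a l *\<^sub>R u l)) \<le> (1 - a k) * norm (y + ?s) + a k * norm ((y + u k) + ?s)"
    using norm_triangle_ineq[of "(1 - a k) *\<^sub>R (y + ?s)" "a k *\<^sub>R ((y + u k) + ?s)"] assms(2)[of k]
    by simp
  also have "\<dots> \<le> B"
    using convex_bound_le[OF 1 2, of "1 - a k" "a k"] assms(2)[of k] by simp
  finally show ?case .
qed (metis empty_subsetI sum.empty)

text \<open>
  The positive and negative parts of the real and imaginary parts of the coefficients each obey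
  the previous bound, which gives the factor 4.
\<close>

lemma norm_sum_complex_coefficients_le:
  fixes u :: "'i \<Rightarrow> 'a::complex_banach" and m :: "'i \<Rightarrow> complex"
  assumes F: "finite F" and m: "\<And>l. cmod (m l) \<le> 1"
    and B: "\<And>G. G \<subseteq> F \<Longrightarrow> norm (sum u G) \<le> B"
  shows "norm (\<Sum>l\<in>F. scaleC (m l) (u l)) \<le> 4 * B"
proof -
  have part: "norm (\<Sum>l\<in>F. max 0 (g (m l)) *\<^sub>R u l) \<le> B" if g: "\<And>z. g z \<le> cmod z" for g
  proof -
    have "max 0 (g (m l)) \<le> 1" for l
      using g[of "m l"] m[of l] by linarith
    then have "norm (0 + (\<Sum>l\<in>F. max 0 (g (m l)) *\<^sub>R u l)) \<le> B"
      using B by (intro norm_sum_convex_coefficients_le[OF F]) auto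
    then show ?thesis by simp
  qed
  have triangle: "norm ((a - b) + scaleC \<i> (c - d)) \<le> (norm a + norm b) + (norm c + norm d)" for a b c d :: 'a
    using norm_triangle_ineq[of "a - b" "scaleC \<i> (c - d)"] norm_triangle_ineq4[of a b] norm_triangle_ineq4[of c d]
    by (simp add: norm_scaleC)
  let ?s = "\<lambda>g. \<Sum>l\<in>F. max 0 (g (m l)) *\<^sub>R u l"
  let ?r = "?s Re" and ?r' = "?s (\<lambda>z. - Re z)" and ?i = "?s Im" and ?i' = "?s (\<lambda>z. - Im z)"
  have coeff: "m l = complex_of_real (max 0 (Re (m l))) - complex_of_real (max 0 (- Re (m l)))
    + \<i> * (complex_of_real (max 0 (Im (m l))) - complex_of_real (max 0 (- Im (m l))))" for l
    by (simp add: complex_eq_iff max_def)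
  have "scaleC (m l) (u l) = max 0 (Re (m l)) *\<^sub>R u l - max 0 (- Re (m l)) *\<^sub>R u l
    + scaleC \<i> (max 0 (Im (m l)) *\<^sub>R u l - max 0 (- Im (m l)) *\<^sub>R u l)" for l
    by (subst coeff)
      (simp only: scaleC.add_left scaleC.diff_left scaleC_of_real scaleC_scaleC[symmetric])
  then have split: "(\<Sum>l\<in>F. scaleC (m l) (u l)) = (?r - ?r') + scaleC \<i> (?i - ?i')"
    by (simp add: sum.distrib sum_subtractf scaleC.sum_right[symmetric])
  have "norm (\<Sum>l\<in>F. scaleC (m l) (u l)) \<le> (norm ?r + norm ?r') + (norm ?i + norm ?i')"
    unfolding split by (rule triangle)
  also have "\<dots> \<le> (B + B) + (B + B)"
  proof (intro add_mono)
    show "norm ?r \<le> B" by (rule part[of Re]) (rule complex_Re_le_cmod)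
    show "norm ?r' \<le> B" by (rule part[of "\<lambda>z. - Re z"]) (rule abs_Re_le_cmod[THEN abs_le_D2])
    show "norm ?i \<le> B" by (rule part[of Im]) (rule abs_Im_le_cmod[THEN abs_le_D1])
    show "norm ?i' \<le> B" by (rule part[of "\<lambda>z. - Im z"]) (rule abs_Im_le_cmod[THEN abs_le_D2])
  qed
  finally show ?thesis by simp
qed

locale unconditional_decomposition =
  fixes E :: "nat \<Rightarrow> 'a::complex_banach set"
  assumes decomposition: "unconditional_schauder_decomposition E"
begin

lemma subspace_E: "module.subspace scaleC (E l)"
  and closed_E: "closed (E l)"
  and E_nontrivial: "E l \<noteq> {0}"
  using decomposition by (auto simp: unconditional_schauder_decomposition_def)

lemmas E_zero = module.subspace_0[OF module_scaleC subspace_E]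
  and E_add = module.subspace_add[OF module_scaleC subspace_E]
  and E_scaleC = module.subspace_scale[OF module_scaleC subspace_E]
  and E_sum = module.subspace_sum[OF module_scaleC subspace_E]

definition component :: "'a \<Rightarrow> nat \<Rightarrow> 'a" where
  "component x = (THE u. (\<forall>l. u l \<in> E l) \<and> (u has_sum x) UNIV)"

lemma component_ex1: "\<exists>!u. (\<forall>l. u l \<in> E l) \<and> (u has_sum x) UNIV"
  using decomposition by (simp add: unconditional_schauder_decomposition_def)

lemma component_in: "component x l \<in> E l"
  and component_has_sum: "(component x has_sum x) UNIV"
  using theI'[OF component_ex1[of x]] by (auto simp: component_def)

lemma component_eqI:
  assumes "\<And>l. u l \<in> E l" "(u has_sum x) UNIV"
  shows "component x = u"
  unfolding component_def using assms by (intro the1_equality component_ex1) auto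

lemma component_add: "component (x + y) = (\<lambda>l. component x l + component y l)"
  by (intro component_eqI E_add component_in has_sum_add component_has_sum)

lemma component_scaleC: "component (scaleC c x) = (\<lambda>l. scaleC c (component x l))"
  by (intro component_eqI E_scaleC component_in component_has_sum
      has_sum_bounded_linear[OF scaleC.bounded_linear_right])

lemma component_scaleR: "component (r *\<^sub>R x) = (\<lambda>l. r *\<^sub>R component x l)"
  using component_scaleC[of "complex_of_real r" x] by (simp add: scaleC_of_real)

lemma component_of_summand:
  assumes "y \<in> E l"
  shows "component y = (\<lambda>k. if k = l then y else 0)"
proof (rule component_eqI)
  show "((\<lambda>k. if k = l then y else 0) has_sum y) UNIV"
    using has_sum_finite[of "{l}" "\<lambda>k. if k = l then y else 0"]
    by (subst has_sum_cong_neutral[where T = "{l}"]) auto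
qed (use assms E_zero in auto)

text \<open>
  Unconditionality concerns the sums over arbitrary finite sets of indices, not only over initial
  segments.
\<close>

definition psum :: "nat set \<Rightarrow> 'a \<Rightarrow> 'a" where
  "psum F x = (\<Sum>l\<in>F. component x l)"

lemma linear_psum: "linear (psum F)"
  by (rule linearI) (simp_all add: psum_def component_add component_scaleR sum.distrib scaleR_sum_right)

lemmas psum_diff = linear_diff[OF linear_psum]
  and psum_sum = linear_sum[OF linear_psum]
  and psum_scaleR = linear_scale[OF linear_psum]
  and psum_zero = linear_0[OF linear_psum]

lemma psum_tendsto: "((\<lambda>F. psum F x) \<longlongrightarrow> x) (finite_subsets_at_top UNIV)"
  using component_has_sum[of x] by (simp add: has_sum_def psum_def[abs_def])

lemma psum_near:
  assumes "e > 0"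
  obtains N where "\<And>F. finite F \<Longrightarrow> {..<N} \<subseteq> F \<Longrightarrow> norm (psum F x - x) < e"
proof -
  have "\<forall>\<^sub>F F in finite_subsets_at_top UNIV. norm (psum F x - x) < e"
    using tendstoD[OF psum_tendsto assms] by (simp add: dist_norm)
  then obtain F0 where F0: "finite F0" "\<And>F. finite F \<Longrightarrow> F0 \<subseteq> F \<Longrightarrow> norm (psum F x - x) < e"
    unfolding eventually_finite_subsets_at_top by auto
  then obtain N where "F0 \<subseteq> {..<N}"
    using finite_nat_bounded by blast
  then show thesis
    using that[of N] F0 by (meson order_trans)
qed

lemma psum_small_tails:
  assumes "e > 0"
  obtains N where "\<And>F. finite F \<Longrightarrow> F \<inter> {..<N} = {} \<Longrightarrow> norm (psum F x) < e"
proof -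
  obtain N where N: "\<And>F. finite F \<Longrightarrow> {..<N} \<subseteq> F \<Longrightarrow> norm (psum F x - x) < e / 2"
    using psum_near[of "e / 2"] assms by auto
  have "norm (psum F x) < e" if F: "finite F" "F \<inter> {..<N} = {}" for F
  proof -
    have "psum F x = (psum (F \<union> {..<N}) x - x) - (psum {..<N} x - x)"
      using F by (simp add: psum_def sum.union_disjoint)
    then show ?thesis
      using N[of "F \<union> {..<N}"] N[of "{..<N}"] F
        norm_triangle_ineq4[of "psum (F \<union> {..<N}) x - x" "psum {..<N} x - x"] by simp
  qed
  then show thesis by (rule that)
qed

lemma psum_pointwise_bounded: "\<exists>n::nat. \<forall>F. finite F \<longrightarrow> norm (psum F x) \<le> real n"
proof -
  obtain N where N: "\<And>F. finite F \<Longrightarrow> F \<inter> {..<N} = {} \<Longrightarrow> norm (psum F x) < 1"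
    using psum_small_tails[of 1] by auto
  let ?B = "1 + (\<Sum>l<N. norm (component x l))"
  have "norm (psum F x) \<le> ?B" if F: "finite F" for F
  proof -
    have "psum F x = psum (F - {..<N}) x + psum (F \<inter> {..<N}) x"
      unfolding psum_def using sum.Int_Diff[OF F, of "component x" "{..<N}"] by (simp add: add.commute)
    moreover have "norm (psum (F \<inter> {..<N}) x) \<le> (\<Sum>l\<in>F \<inter> {..<N}. norm (component x l))"
      unfolding psum_def by (rule norm_sum)
    moreover have "\<dots> \<le> (\<Sum>l<N. norm (component x l))"
      by (rule sum_mono2) auto
    moreover have "norm (psum (F - {..<N}) x) < 1"
      using F by (intro N) auto
    ultimately show ?thesis
      using norm_triangle_ineq[of "psum (F - {..<N}) x" "psum (F \<inter> {..<N}) x"] by simp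
  qed
  then show ?thesis
    by (meson order_trans real_arch_simple)
qed

text \<open>
  By Baire's theorem the vectors whose partial sums are bounded by some fixed \<open>n\<close> are dense in a
  ball, and differences of such vectors are dense in a ball around the origin. After scaling, every
  \<open>x\<close> can be approximated by vectors whose partial sums are controlled by \<open>norm x\<close>.
\<close>

lemma psum_approximately_bounded:
  "\<exists>c\<ge>0. \<forall>x. \<forall>e>0. \<exists>y. norm (x - y) < e \<and> (\<forall>F. finite F \<longrightarrow> norm (psum F y) \<le> c * norm x)"
proof -
  define A where "A = (\<lambda>n::nat. {x. \<forall>F. finite F \<longrightarrow> norm (psum F x) \<le> real n})"
  have "(\<Union>n. A n) = UNIV"
    using psum_pointwise_bounded by (auto simp: A_def)
  then obtain n a r where r: "r > 0" and ball: "ball a r \<subseteq> closure (A n)"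
    by (rule dense_in_ball_of_countable_union)
  have near: "\<exists>y\<in>A n. norm (z - y) < e" if "z \<in> ball a r" "e > 0" for z e
    using ball that by (metis closure_approachable dist_norm norm_minus_commute subset_iff)
  show ?thesis
  proof (intro exI[of _ "4 * real n / r"] conjI allI impI)
    show "4 * real n / r \<ge> 0" using r by simp
  next
    fix x :: 'a and e :: real assume e: "e > 0"
    show "\<exists>y. norm (x - y) < e \<and> (\<forall>F. finite F \<longrightarrow> norm (psum F y) \<le> 4 * real n / r * norm x)"
    proof (cases "x = 0")
      case True
      then show ?thesis using e by (intro exI[of _ 0]) (simp add: psum_zero)
    next
      case False
      define s where "s = r / (2 * norm x)"
      have s: "s > 0" using r False by (simp add: s_def)
      have "norm (s *\<^sub>R x) < r" using r False by (simp add: s_def)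
      then have "a + s *\<^sub>R x \<in> ball a r" by (simp add: dist_norm)
      then obtain y1 where y1: "y1 \<in> A n" "norm (a + s *\<^sub>R x - y1) < e * s / 2"
        using near[of "a + s *\<^sub>R x" "e * s / 2"] e s by auto
      obtain y2 where y2: "y2 \<in> A n" "norm (a - y2) < e * s / 2"
        using near[of a "e * s / 2"] e s r by auto
      define y where "y = (1 / s) *\<^sub>R (y1 - y2)"
      have "s *\<^sub>R (x - y) = (a + s *\<^sub>R x - y1) - (a - y2)"
        using s by (simp add: y_def algebra_simps)
      then have "norm (s *\<^sub>R (x - y)) < e * s"
        using y1(2) y2(2) norm_triangle_ineq4[of "a + s *\<^sub>R x - y1" "a - y2"] by simp
      then have "norm (x - y) < e" using s by (simp add: mult.commute)
      moreover have "norm (psum F y) \<le> 4 * real n / r * norm x" if F: "finite F" for F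
      proof -
        have "norm (psum F y1 - psum F y2) \<le> real n + real n"
          using y1(1) y2(1) F norm_triangle_ineq4[of "psum F y1" "psum F y2"] by (force simp: A_def)
        then have "norm (psum F y) \<le> 2 * real n / s"
          using s by (simp add: y_def psum_scaleR psum_diff divide_right_mono)
        then show ?thesis using r False by (simp add: s_def field_simps)
      qed
      ultimately show ?thesis by blast
    qed
  qed
qed

text \<open>
  The iteration of the open mapping theorem: successive approximation of the error writes \<open>x\<close> as a
  series of controlled vectors \<open>y k\<close>. Adding up their components gives, by uniform convergence over
  all finite index sets, an unconditional expansion of \<open>x\<close>. By uniqueness it is the expansion of
  \<open>x\<close>, whose partial sums are therefore controlled as well.
\<close>

lemma psum_uniformly_bounded:
  "\<exists>c\<ge>0. \<forall>F x. finite F \<longrightarrow> norm (psum F x) \<le> c * norm x"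
proof -
  obtain c where c: "c \<ge> 0"
    and approx: "\<forall>x. \<forall>e>0. \<exists>y. norm (x - y) < e \<and> (\<forall>F. finite F \<longrightarrow> norm (psum F y) \<le> c * norm x)"
    using psum_approximately_bounded by (elim exE conjE) (rule that)
  have "\<forall>x e. \<exists>y. e > 0 \<longrightarrow> norm (x - y) < e \<and> (\<forall>F. finite F \<longrightarrow> norm (psum F y) \<le> c * norm x)"
    using approx by blast
  then obtain app where app: "\<And>x e. e > 0 \<Longrightarrow> norm (x - app x e) < e"
    "\<And>x e F. e > 0 \<Longrightarrow> finite F \<Longrightarrow> norm (psum F (app x e)) \<le> c * norm x"
    unfolding choice_iff by blast
  have "norm (psum F x) \<le> (2 * c) * norm x" if F: "finite F" for F x
  proof (cases "x = 0")
    case False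
    define \<beta> where "\<beta> = (\<lambda>k. norm x * (1/2) ^ k)"
    have \<beta>: "\<beta> k > 0" for k using False by (simp add: \<beta>_def)
    define r where "r = rec_nat x (\<lambda>k z. z - app z (\<beta> (Suc k)))"
    define y where "y = (\<lambda>k. app (r k) (\<beta> (Suc k)))"
    have r: "r 0 = x" "r (Suc k) = r k - y k" for k
      by (simp_all add: r_def y_def)
    have r_le: "norm (r k) \<le> \<beta> k" for k
    proof (cases k)
      case (Suc n)
      then show ?thesis
        using app(1)[OF \<beta>, of "r n" "Suc n"] by (simp add: r y_def)
    qed (simp add: r \<beta>_def)
    have y_le: "norm (psum F (y k)) \<le> c * \<beta> k" if "finite F" for F k
      using app(2)[OF \<beta> that, of "r k"] r_le[of k] c
      by (auto simp: y_def intro: order_trans mult_left_mono)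
    have part: "(\<Sum>k<n. y k) = x - r n" for n
      by (induction n) (simp_all add: r)
    have \<beta>_sums: "(\<lambda>k. c * \<beta> k) sums (2 * c * norm x)"
      using sums_mult[OF geometric_sums[of "1/2::real"], of "c * norm x"]
      by (simp add: \<beta>_def mult.assoc mult.left_commute mult.commute)
    have "\<beta> \<longlonglongrightarrow> norm x * 0"
      unfolding \<beta>_def by (intro tendsto_intros) auto
    then have \<beta>_lim: "\<beta> \<longlonglongrightarrow> 0"
      by simp
    have "(\<lambda>k. norm (r k)) \<longlonglongrightarrow> 0"
      by (rule tendsto_sandwich[OF _ _ tendsto_const \<beta>_lim]) (use r_le in auto)
    then have "r \<longlonglongrightarrow> 0"
      by (rule tendsto_norm_zero_cancel)
    then have lim: "(\<lambda>n. \<Sum>k<n. y k) \<longlonglongrightarrow> x"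
      unfolding part using tendsto_diff[OF tendsto_const, of r 0 sequentially x] by simp
    define v where "v = (\<lambda>l. \<Sum>k. component (y k) l)"
    have comp_summable: "summable (\<lambda>k. component (y k) l)" for l
      by (rule summable_comparison_test'[OF sums_summable[OF \<beta>_sums], of 0])
         (use y_le[of "{l}"] in \<open>simp add: psum_def\<close>)
    have v_in: "v l \<in> E l" for l
    proof (rule closed_sequentially[OF closed_E])
      show "(\<lambda>n. \<Sum>k<n. component (y k) l) \<longlonglongrightarrow> v l"
        unfolding v_def by (rule summable_LIMSEQ[OF comp_summable])
    qed (intro E_sum component_in)
    have v_sum: "sum v G = (\<Sum>k. psum G (y k))" for G
      unfolding v_def psum_def by (rule suminf_sum[symmetric]) (rule comp_summable)
    have unif: "uniform_limit {G. finite G} (\<lambda>n G. \<Sum>k<n. psum G (y k)) (\<lambda>G. sum v G) sequentially"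
      unfolding v_sum by (rule Weierstrass_m_test[OF _ sums_summable[OF \<beta>_sums]]) (use y_le in auto)
    have "(sum v \<longlongrightarrow> x) (finite_subsets_at_top UNIV)"
    proof (rule swap_uniform_limit'[OF _ lim unif])
      show "\<forall>\<^sub>F n in sequentially.
          ((\<lambda>G. \<Sum>k<n. psum G (y k)) \<longlongrightarrow> (\<Sum>k<n. y k)) (finite_subsets_at_top UNIV)"
        unfolding psum_sum[symmetric] by (intro always_eventually allI psum_tendsto)
    qed (auto intro!: eventually_finite_subsets_at_top_weakI)
    then have "component x = v"
      using v_in by (intro component_eqI) (auto simp: has_sum_def)
    then have "psum F x = (\<Sum>k. psum F (y k))"
      using v_sum[of F] by (simp add: psum_def)
    also have "norm \<dots> \<le> (\<Sum>k. c * \<beta> k)"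
      by (rule norm_suminf_le) (use y_le[OF F] sums_summable[OF \<beta>_sums] in auto)
    also have "\<dots> = 2 * c * norm x"
      using \<beta>_sums by (rule sums_unique[symmetric])
    finally show ?thesis .
  qed (simp add: psum_zero)
  then show ?thesis
    using c by (intro exI[of _ "2 * c"]) simp
qed

text \<open>
  The diagonal operators of the decomposition. They are the reason why the decomposition has to be
  unconditional: phases that vary from one summand to the next define operators bounded uniformly
  in the phases.
\<close>

definition multiplier :: "(nat \<Rightarrow> complex) \<Rightarrow> 'a \<Rightarrow> 'a" where
  "multiplier m x = (\<Sum>l. scaleC (m l) (component x l))"

lemma multiplier_sums:
  assumes m: "\<And>l. cmod (m l) \<le> 1"
  shows "(\<lambda>l. scaleC (m l) (component x l)) sums multiplier m x"
  unfolding multiplier_def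
proof (rule summable_sums, unfold summable_Cauchy, intro allI impI)
  fix e :: real assume "e > 0"
  then obtain N where N: "\<And>F. finite F \<Longrightarrow> F \<inter> {..<N} = {} \<Longrightarrow> norm (psum F x) < e / 5"
    using psum_small_tails[of "e / 5"] by auto
  have "norm (\<Sum>l=i..<j. scaleC (m l) (component x l)) < e" if "i \<ge> N" for i j
  proof -
    have "norm (\<Sum>l=i..<j. scaleC (m l) (component x l)) \<le> 4 * (e / 5)"
    proof (rule norm_sum_complex_coefficients_le)
      fix G assume "G \<subseteq> {i..<j}"
      then have "finite G" "G \<inter> {..<N} = {}"
        using that by (auto intro: finite_subset)
      from N[OF this] show "norm (sum (component x) G) \<le> e / 5"
        by (simp add: psum_def)
    qed (use m in auto)
    then show ?thesis using \<open>e > 0\<close> by linarith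
  qed
  then show "\<exists>N. \<forall>i\<ge>N. \<forall>j. norm (\<Sum>l=i..<j. scaleC (m l) (component x l)) < e"
    by (intro exI[of _ N] allI impI)
qed

lemma multiplier_add:
  assumes "\<And>l. cmod (m l) \<le> 1"
  shows "multiplier m (x + y) = multiplier m x + multiplier m y"
proof (rule sums_unique2[OF multiplier_sums[of m, OF assms]])
  show "(\<lambda>l. scaleC (m l) (component (x + y) l)) sums (multiplier m x + multiplier m y)"
    unfolding component_add scaleC_add_right
    by (rule sums_add[OF multiplier_sums[of m, OF assms] multiplier_sums[of m, OF assms]])
qed

lemma multiplier_scaleC:
  assumes "\<And>l. cmod (m l) \<le> 1"
  shows "multiplier m (scaleC c x) = scaleC c (multiplier m x)"
proof (rule sums_unique2[OF multiplier_sums[of m, OF assms]])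
  show "(\<lambda>l. scaleC (m l) (component (scaleC c x) l)) sums scaleC c (multiplier m x)"
  proof -
    have "(\<lambda>l. scaleC c (scaleC (m l) (component x l))) sums scaleC c (multiplier m x)"
      by (rule bounded_linear.sums[OF scaleC.bounded_linear_right multiplier_sums[of m, OF assms]])
    moreover have "scaleC c (scaleC (m l) (component x l)) = scaleC (m l) (component (scaleC c x) l)" for l
      by (simp add: component_scaleC scaleC_scaleC mult.commute)
    ultimately show ?thesis by simp
  qed
qed

lemma multiplier_bounded:
  "\<exists>c\<ge>0. \<forall>m x. (\<forall>l. cmod (m l) \<le> 1) \<longrightarrow> norm (multiplier m x) \<le> c * norm x"
proof -
  obtain c where c: "c \<ge> 0" "\<And>F x. finite F \<Longrightarrow> norm (psum F x) \<le> c * norm x"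
    using psum_uniformly_bounded by blast
  have "norm (multiplier m x) \<le> 4 * c * norm x" if m: "\<And>l. cmod (m l) \<le> 1" for m x
  proof (rule Lim_norm_ubound)
    show "(\<lambda>n. \<Sum>l<n. scaleC (m l) (component x l)) \<longlonglongrightarrow> multiplier m x"
      using multiplier_sums[of m, OF m] by (simp add: sums_def)
    have "norm (\<Sum>l<n. scaleC (m l) (component x l)) \<le> 4 * (c * norm x)" for n
    proof (rule norm_sum_complex_coefficients_le)
      fix G assume "G \<subseteq> {..<n}"
      then show "norm (sum (component x) G) \<le> c * norm x"
        using c(2)[of G x] by (simp add: psum_def finite_subset)
    qed (use m in auto)
    then show "\<forall>\<^sub>F n in sequentially. norm (\<Sum>l<n. scaleC (m l) (component x l)) \<le> 4 * c * norm x"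
      by (simp add: mult.assoc)
  qed simp
  then show ?thesis
    using c by (intro exI[of _ "4 * c"]) simp
qed

lemma multiplier_of_summand:
  assumes "y \<in> E l"
  shows "multiplier m y = scaleC (m l) y"
proof -
  have "(\<lambda>k. scaleC (m k) (component y k)) = (\<lambda>k. if k = l then scaleC (m l) y else 0)"
    by (auto simp: component_of_summand[OF assms] scaleC.zero_right)
  moreover have "(\<lambda>k. if k = l then scaleC (m l) y else 0) sums scaleC (m l) y"
    by (rule sums_single)
  ultimately show ?thesis
    unfolding multiplier_def by (simp only: sums_unique[symmetric])
qed

lemma bounded_linear_component: "bounded_linear (\<lambda>x. component x l)"
proof -
  obtain c where c: "\<And>F x. finite F \<Longrightarrow> norm (psum F x) \<le> c * norm x"
    using psum_uniformly_bounded by blast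
  show ?thesis
    by (rule bounded_linear_intro[of _ c])
       (use c[of "{l}"] in \<open>auto simp: component_add component_scaleR psum_def mult.commute\<close>)
qed

text \<open>
  The functionals vanish on the whole of the other summands, not only at the other vectors \<open>e k\<close>, so
  that operators built from them can be evaluated at an arbitrary vector of a summand.
\<close>

definition biorthogonal :: "(nat \<Rightarrow> 'a) \<Rightarrow> (nat \<Rightarrow> 'a \<Rightarrow> complex) \<Rightarrow> bool" where
  "biorthogonal e f \<longleftrightarrow>
     (\<forall>l. norm (e l) = 1 \<and> e l \<in> E l \<and> bounded_linear (f l) \<and>
          (\<forall>c x. f l (scaleC c x) = c * f l x) \<and> f l (e l) = 1) \<and>
     (\<forall>k l. \<forall>y\<in>E k. k \<noteq> l \<longrightarrow> f l y = 0)"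

lemma biorthogonalD:
  assumes "biorthogonal e f"
  shows "norm (e l) = 1" "e l \<in> E l" "bounded_linear (f l)" "f l (scaleC c x) = c * f l x"
    "f l (e k) = (if k = l then 1 else 0)" "y \<in> E k \<Longrightarrow> k \<noteq> l \<Longrightarrow> f l y = 0"
  using assms unfolding biorthogonal_def by auto

lemma biorthogonal_exists: "\<exists>e f. biorthogonal e f"
proof -
  have "\<exists>e f. norm e = 1 \<and> e \<in> E l \<and> bounded_linear f \<and>
      (\<forall>c x. f (scaleC c x) = c * f x) \<and> f e = (1 :: complex)" for l
  proof -
    obtain z where z: "z \<in> E l" "z \<noteq> 0"
      using E_nontrivial[of l] E_zero[of l] by blast
    define e where "e = scaleC (complex_of_real (1 / norm z)) z"
    have "norm e = 1" "e \<in> E l"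
      using z E_scaleC by (auto simp: e_def norm_scaleC norm_divide)
    moreover from this obtain f where "bounded_linear f" "\<And>c x. f (scaleC c x) = c * f x" "f e = 1"
      using complex_functional_nonzero[of e] by (metis norm_zero zero_neq_one)
    ultimately show ?thesis by blast
  qed
  then obtain e and f :: "nat \<Rightarrow> 'a \<Rightarrow> complex" where e: "\<And>l. norm (e l) = 1" "\<And>l. e l \<in> E l"
    and f: "\<And>l. bounded_linear (f l)" "\<And>l c x. f l (scaleC c x) = c * f l x" "\<And>l. f l (e l) = 1"
    by metis
  have "biorthogonal e (\<lambda>l x. f l (component x l))"
    unfolding biorthogonal_def
  proof (intro conjI allI ballI impI)
    show "bounded_linear (\<lambda>x. f l (component x l))" for l
      by (rule bounded_linear_compose[OF f(1) bounded_linear_component])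
    show "f l (component (e l) l) = 1" for l
      by (simp add: component_of_summand[OF e(2)] f(3))
    show "f l (component y l) = 0" if "y \<in> E k" "k \<noteq> l" for k l y
      using that by (simp add: component_of_summand linear_0[OF bounded_linear.linear[OF f(1)]])
  qed (simp_all add: e f(2) component_scaleC)
  then show ?thesis by blast
qed

text \<open>
  The summands span a dense subspace. This and the next lemma reduce the semigroup law and strong
  continuity to vectors of a single summand.
\<close>

lemma eq_on_summands_imp_eq:
  assumes S: "bounded_linear S" and T: "bounded_linear T"
    and eq: "\<And>l y. y \<in> E l \<Longrightarrow> S y = T y"
  shows "S x = T x"
proof -
  have "((\<lambda>l. S (component x l)) has_sum S x) UNIV" "((\<lambda>l. T (component x l)) has_sum T x) UNIV"
    by (rule has_sum_bounded_linear[OF _ component_has_sum], fact)+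
  then show ?thesis
    using eq[OF component_in] by (simp add: has_sum_unique)
qed

lemma continuous_on_orbit:
  assumes T: "\<And>t. t \<in> I \<Longrightarrow> linear (T t)"
    and bound: "\<And>t x. t \<in> I \<Longrightarrow> norm (T t x) \<le> K * norm x"
    and cont: "\<And>l y. y \<in> E l \<Longrightarrow> continuous_on I (\<lambda>t. T t y)"
  shows "continuous_on I (\<lambda>t. T t x)"
proof (rule uniform_limit_theorem)
  let ?s = "\<lambda>n. \<Sum>l<n. component x l"
  have T_sum: "T t (?s n) = (\<Sum>l<n. T t (component x l))" if "t \<in> I" for t n
    by (rule linear_sum[OF T[OF that]])
  have "continuous_on I (\<lambda>t. T t (?s n))" for n
    using continuous_on_sum[of "{..<n}" I "\<lambda>l t. T t (component x l)"] cont[OF component_in]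
    by (simp add: T_sum cong: continuous_on_cong)
  then show "\<forall>\<^sub>F n in sequentially. continuous_on I (\<lambda>t. T t (?s n))"
    by simp
  have s: "?s \<longlonglongrightarrow> x"
    using has_sum_imp_sums[OF component_has_sum[of x]] by (simp add: sums_def)
  show "uniform_limit I (\<lambda>n t. T t (?s n)) (\<lambda>t. T t x) sequentially"
  proof (rule uniform_limitI)
    fix e :: real assume e: "e > 0"
    have "(\<lambda>n. \<bar>K\<bar> * norm (?s n - x)) \<longlonglongrightarrow> \<bar>K\<bar> * norm (x - x)"
      by (intro tendsto_intros s)
    then have "\<forall>\<^sub>F n in sequentially. \<bar>K\<bar> * norm (?s n - x) < e"
      using e by (intro order_tendstoD(2)[of _ 0]) auto
    then show "\<forall>\<^sub>F n in sequentially. \<forall>t\<in>I. dist (T t (?s n)) (T t x) < e"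
    proof eventually_elim
      case (elim n)
      have "norm (T t (?s n) - T t x) \<le> \<bar>K\<bar> * norm (?s n - x)" if "t \<in> I" for t
        using bound[OF that, of "?s n - x"] linear_diff[OF T[OF that], of "?s n" x]
          mult_right_mono[OF abs_ge_self[of K] norm_ge_zero[of "?s n - x"]] by simp
      then show ?case
        using elim by (auto simp: dist_norm intro: order_le_less_trans)
    qed
  qed
qed simp

end

text \<open>
  Coordinate functionals show that the vectors \<open>e l\<close> are linearly independent.
\<close>

lemma infinite_dimensional_if_decomposition:
  assumes "unconditional_schauder_decomposition (E :: nat \<Rightarrow> 'a::complex_banach set)"
  shows "infinite_dimensional TYPE('a)"
proof -
  interpret unconditional_decomposition E
    by unfold_locales (rule assms)
  interpret V: vector_space "scaleC :: complex \<Rightarrow> 'a \<Rightarrow> 'a"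
    by unfold_locales (simp_all add: scaleC_add_right scaleC_add_left scaleC_scaleC scaleC_one)
  obtain e f where ef: "biorthogonal e f"
    using biorthogonal_exists by blast
  note f_e = biorthogonalD(5)[OF ef] and f_scale = biorthogonalD(4)[OF ef]
  have f_lin: "linear (f l)" for l
    using biorthogonalD(3)[OF ef] by (rule bounded_linear.linear)
  have "inj e"
    by (rule injI) (metis f_e zero_neq_one)
  have "V.independent (range e)"
  proof
    assume "V.dependent (range e)"
    then obtain S u v where S: "finite S" "S \<subseteq> range e" "v \<in> S" "u v \<noteq> 0" "(\<Sum>w\<in>S. scaleC (u w) w) = 0"
      unfolding V.dependent_explicit by blast
    then obtain l where l: "v = e l" by blast
    have "f l (\<Sum>w\<in>S. scaleC (u w) w) = (\<Sum>w\<in>S. u w * f l w)"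
      by (simp add: linear_sum[OF f_lin] f_scale)
    also have "\<dots> = (\<Sum>w\<in>S. if w = v then u v else 0)"
    proof (rule sum.cong[OF refl])
      fix w assume "w \<in> S"
      then obtain k where "w = e k" using S(2) by blast
      then show "u w * f l w = (if w = v then u v else 0)"
        using l f_e[of l k] inj_eq[OF \<open>inj e\<close>, of k l] by (cases "k = l") simp_all
    qed
    also have "\<dots> = u v"
      using S by simp
    finally show False
      using S by (simp add: linear_0[OF f_lin])
  qed
  moreover have "infinite (range e)"
    using \<open>inj e\<close> by (simp add: finite_image_iff)
  ultimately show ?thesis
    unfolding infinite_dimensional_def using V.independent_span_bound by blast
qed

section \<open>A semigroup indexed by the binary tree\<close>

text \<open>
  The nodes of the tree are the finite sets of natural numbers, coded as natural numbers by
  \<open>set_encode\<close>; the parent of a nonempty set is obtained by removing its maximum. The empty set has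
  code 0, and \<open>parent 0\<close> is the empty set whatever the value of \<open>level 0\<close>, so the root is its own
  parent.
\<close>

definition level :: "nat \<Rightarrow> nat" where
  "level n = Max (set_decode n)"

definition parent :: "nat \<Rightarrow> nat set" where
  "parent n = set_decode n - {level n}"

text \<open>
  The sum runs over the path from the root to \<open>A\<close>, whose nodes are the sets \<open>A \<inter> {..b}\<close> with \<open>b \<in> A\<close>.
  The weights decay, hence node vectors converge along every infinite branch. The edge vector
  is the direction in which \<open>T t (e n)\<close> has to deviate from the line of \<open>e n\<close> if every node vector is
  to be an eigenvector of \<open>T t\<close>; the power of 2 undoes the weight of \<open>e n\<close> in the node vector.
\<close>

definition node_vector :: "(nat \<Rightarrow> 'a::real_vector) \<Rightarrow> nat set \<Rightarrow> 'a" where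
  "node_vector e A = e 0 + (\<Sum>b\<in>A. (1/2) ^ b *\<^sub>R e (set_encode (A \<inter> {..b})))"

definition edge_vector :: "(nat \<Rightarrow> 'a::real_vector) \<Rightarrow> nat \<Rightarrow> 'a" where
  "edge_vector e n = 2 ^ level n *\<^sub>R node_vector e (parent n)"

lemma node_vector_insert:
  assumes A: "finite A" "\<And>a. a \<in> A \<Longrightarrow> a < b"
  shows "node_vector e (insert b A) = node_vector e A + (1/2) ^ b *\<^sub>R e (set_encode (insert b A))"
proof -
  have "insert b A \<inter> {..a} = A \<inter> {..a}" if "a \<in> A" for a
    using A(2)[OF that] by auto
  moreover have "insert b A \<inter> {..b} = insert b A"
    using A(2) by fastforce
  moreover have "b \<notin> A" using A(2) by blast
  ultimately show ?thesis
    using A(1) by (simp add: node_vector_def)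
qed

lemma level_insert:
  assumes A: "finite A" "\<And>a. a \<in> A \<Longrightarrow> a < b"
  shows "level (set_encode (insert b A)) = b" "parent (set_encode (insert b A)) = A"
proof -
  have "Max (insert b A) = b"
    using A by (intro Max_eqI) (auto intro: less_imp_le)
  then show 1: "level (set_encode (insert b A)) = b"
    using A by (simp add: level_def)
  have "b \<notin> A" using A(2) by blast
  then show "parent (set_encode (insert b A)) = A"
    using A unfolding parent_def 1 by (simp del: set_encode_insert)
qed

text \<open>
  The numbers \<open>\<theta> b\<close> are the increments of the frequencies from a node to its children at level \<open>b\<close>.
  The condition on the bound \<open>\<delta>\<close> involves the vectors and functionals alone; this allows \<open>\<theta>\<close> to be
  chosen after them, small enough to make the coupling between nodes summable. The factor 3 separates
  the frequencies of different branches.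
\<close>

locale tree_semigroup = unconditional_decomposition E
  for E :: "nat \<Rightarrow> 'a::complex_banach set" +
  fixes e :: "nat \<Rightarrow> 'a" and f :: "nat \<Rightarrow> 'a \<Rightarrow> complex" and \<theta> \<delta> :: "nat \<Rightarrow> real"
  assumes biorthogonal: "biorthogonal e f"
    and theta_pos: "\<And>b. \<theta> b > 0"
    and theta_le: "\<And>b. \<theta> b \<le> \<delta> b"
    and theta_third: "\<And>b. \<theta> (Suc b) \<le> \<theta> b / 3"
    and delta_small: "\<And>n. n \<noteq> 0 \<Longrightarrow> \<delta> (level n) * (onorm (f n) * norm (edge_vector e n)) \<le> (1/2) ^ n"
begin

lemmas norm_e = biorthogonalD(1)[OF biorthogonal]
  and e_in = biorthogonalD(2)[OF biorthogonal]
  and bounded_linear_f = biorthogonalD(3)[OF biorthogonal]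
  and f_scaleC = biorthogonalD(4)[OF biorthogonal]
  and f_e = biorthogonalD(5)[OF biorthogonal]
  and f_other = biorthogonalD(6)[OF biorthogonal]

lemma linear_f: "linear (f n)"
  by (rule bounded_linear.linear[OF bounded_linear_f])

definition frequency :: "nat set \<Rightarrow> real" where
  "frequency A = (\<Sum>b\<in>A. \<theta> b)"

definition coupling :: "real \<Rightarrow> nat \<Rightarrow> complex" where
  "coupling t n = cis (frequency (set_decode n) * t) - cis (frequency (parent n) * t)"

text \<open>
  The operators are designed so that each node vector is an eigenvector: node vectors differ from
  those of their parents by a multiple of \<open>e n\<close>, which determines the value at \<open>e n\<close> as in
  \<open>T_summand\<close>. The result is a diagonal operator perturbed by an absolutely convergent series of
  operators of rank one.
\<close>

definition T :: "real \<Rightarrow> 'a \<Rightarrow> 'a" where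
  "T t x = multiplier (\<lambda>l. cis (frequency (set_decode l) * t)) x
     + (\<Sum>n. scaleC (coupling t n * f n x) (edge_vector e n))"

lemma coupling_zero: "coupling t 0 = 0"
  by (simp add: coupling_def parent_def)

text \<open>
  The frequencies of a node and its parent differ by \<open>\<theta> (level n)\<close>.
\<close>

lemma norm_coupling:
  assumes "n \<noteq> 0"
  shows "cmod (coupling t n) = cmod (cis (\<theta> (level n) * t) - 1)"
proof -
  have ne: "set_decode n \<noteq> {}"
    using assms by (metis set_decode_inverse set_encode_empty)
  have "frequency (set_decode n) = \<theta> (level n) + frequency (parent n)"
    using sum.remove[of "set_decode n" "level n" \<theta>] Max_in[OF finite_set_decode ne]
    by (simp add: frequency_def parent_def level_def)
  then have "coupling t n = (cis (\<theta> (level n) * t) - 1) * cis (frequency (parent n) * t)"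
    by (simp add: coupling_def algebra_simps cis_mult)
  then show ?thesis
    by (simp add: norm_mult)
qed

text \<open>
  All estimates for \<open>T t\<close> are linear in \<open>M\<close>. The value \<open>M = \<bar>t\<bar>\<close> is always possible, since \<open>\<theta> \<le> \<delta>\<close>; this
  makes \<open>T t\<close> a bounded operator, locally uniformly in \<open>t\<close>. At the times where the phases return
  close to 1 the value \<open>M = 1\<close> is possible; this gives partial boundedness.
\<close>

definition coupled :: "real \<Rightarrow> real \<Rightarrow> bool" where
  "coupled M t \<longleftrightarrow> M \<ge> 0 \<and> (\<forall>b. cmod (cis (\<theta> b * t) - 1) \<le> M * \<delta> b)"

lemma coupled_abs: "coupled \<bar>t\<bar> t"
  unfolding coupled_def
proof (intro conjI allI)
  fix b
  have "cmod (cis (\<theta> b * t) - 1) \<le> \<bar>\<theta> b * t\<bar>"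
    by (rule norm_cis_minus_one_le)
  also have "\<dots> \<le> \<bar>t\<bar> * \<delta> b"
    using theta_pos[of b] theta_le[of b] by (simp add: abs_mult mult.commute mult_left_mono)
  finally show "cmod (cis (\<theta> b * t) - 1) \<le> \<bar>t\<bar> * \<delta> b" .
qed simp

lemma coupling_term_bound:
  assumes M: "coupled M t"
  shows "norm (scaleC (coupling t n * f n x) (edge_vector e n)) \<le> M * norm x * (1/2) ^ n"
proof (cases "n = 0")
  case False
  have fx: "cmod (f n x) \<le> onorm (f n) * norm x"
    by (rule onorm[OF bounded_linear_f])
  have "norm (scaleC (coupling t n * f n x) (edge_vector e n))
      = cmod (coupling t n) * cmod (f n x) * norm (edge_vector e n)"
    by (simp add: norm_scaleC norm_mult)
  also have "\<dots> \<le> (M * \<delta> (level n)) * (onorm (f n) * norm x) * norm (edge_vector e n)"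
    using M fx unfolding norm_coupling[OF False] coupled_def
    by (intro mult_mono) (auto intro: order_trans[OF norm_ge_zero] mult_nonneg_nonneg onorm_pos_le[OF bounded_linear_f])
  also have "\<dots> = M * norm x * (\<delta> (level n) * (onorm (f n) * norm (edge_vector e n)))"
    by (simp add: algebra_simps)
  also have "\<dots> \<le> M * norm x * (1/2) ^ n"
    using delta_small[OF False] M by (intro mult_left_mono) (auto simp: coupled_def)
  finally show ?thesis .
qed (use M in \<open>simp add: coupling_zero coupled_def scaleC.zero_left\<close>)

lemma coupling_summable: "summable (\<lambda>n. scaleC (coupling t n * f n x) (edge_vector e n))"
  and norm_coupling_sum: "coupled M t \<Longrightarrow>
    norm (\<Sum>n. scaleC (coupling t n * f n x) (edge_vector e n)) \<le> 2 * M * norm x"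
proof -
  have geo: "(\<lambda>n. m * norm x * (1/2) ^ n) sums (2 * m * norm x)" for m
    using sums_mult[OF geometric_sums[of "1/2::real"], of "m * norm x"] by (simp add: ac_simps)
  show "summable (\<lambda>n. scaleC (coupling t n * f n x) (edge_vector e n))"
    by (rule summable_comparison_test'[OF sums_summable[OF geo], of 0])
       (rule coupling_term_bound[OF coupled_abs])
  assume M: "coupled M t"
  have "norm (\<Sum>n. scaleC (coupling t n * f n x) (edge_vector e n)) \<le> (\<Sum>n. M * norm x * (1/2) ^ n)"
    by (rule norm_suminf_le[OF coupling_term_bound[OF M] sums_summable[OF geo]])
  then show "norm (\<Sum>n. scaleC (coupling t n * f n x) (edge_vector e n)) \<le> 2 * M * norm x"
    using sums_unique[OF geo[of M]] by simp
qed

lemma T_add: "T t (x + y) = T t x + T t y"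
proof -
  have "(\<Sum>n. scaleC (coupling t n * f n (x + y)) (edge_vector e n))
      = (\<Sum>n. scaleC (coupling t n * f n x) (edge_vector e n) + scaleC (coupling t n * f n y) (edge_vector e n))"
    by (simp add: linear_add[OF linear_f] distrib_left scaleC_add_left)
  also have "\<dots> = (\<Sum>n. scaleC (coupling t n * f n x) (edge_vector e n))
      + (\<Sum>n. scaleC (coupling t n * f n y) (edge_vector e n))"
    by (rule suminf_add[OF coupling_summable coupling_summable, symmetric])
  finally show ?thesis
    by (simp add: T_def multiplier_add)
qed

lemma T_scaleC: "T t (scaleC c x) = scaleC c (T t x)"
proof -
  have "(\<Sum>n. scaleC (coupling t n * f n (scaleC c x)) (edge_vector e n))
      = (\<Sum>n. scaleC c (scaleC (coupling t n * f n x) (edge_vector e n)))"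
    by (simp add: f_scaleC scaleC_scaleC mult.left_commute)
  also have "\<dots> = scaleC c (\<Sum>n. scaleC (coupling t n * f n x) (edge_vector e n))"
    by (rule bounded_linear.suminf[OF scaleC.bounded_linear_right coupling_summable, symmetric])
  finally show ?thesis
    by (simp add: T_def multiplier_scaleC scaleC_add_right)
qed

lemma T_bound: "\<exists>c\<ge>0. \<forall>M t x. coupled M t \<longrightarrow> norm (T t x) \<le> (c + 2 * M) * norm x"
proof -
  obtain c where c: "c \<ge> 0" "\<And>m x. (\<forall>l. cmod (m l) \<le> 1) \<Longrightarrow> norm (multiplier m x) \<le> c * norm x"
    using multiplier_bounded by blast
  have "norm (T t x) \<le> (c + 2 * M) * norm x" if "coupled M t" for M t x
    unfolding T_def
    using norm_triangle_le[OF add_mono[OF c(2) norm_coupling_sum[OF that]]]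
    by (simp add: algebra_simps)
  then show ?thesis using c(1) by blast
qed

lemma bounded_linear_T: "bounded_linear (T t)"
proof -
  obtain c where c: "\<And>M t x. coupled M t \<Longrightarrow> norm (T t x) \<le> (c + 2 * M) * norm x"
    using T_bound by blast
  show ?thesis
    by (rule bounded_linear_intro[of _ "c + 2 * \<bar>t\<bar>"])
       (use c[OF coupled_abs] in \<open>auto simp: T_add T_scaleC mult.commute simp flip: scaleC_of_real\<close>)
qed

lemma T_summand:
  assumes y: "y \<in> E l"
  shows "T t y = scaleC (cis (frequency (set_decode l) * t)) y + scaleC (coupling t l * f l y) (edge_vector e l)"
proof -
  have "(\<lambda>n. scaleC (coupling t n * f n y) (edge_vector e n))
      = (\<lambda>n. if n = l then scaleC (coupling t l * f l y) (edge_vector e l) else 0)"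
    using f_other[OF y] by (auto simp: scaleC.zero_left)
  moreover have "\<dots> sums scaleC (coupling t l * f l y) (edge_vector e l)"
    by (rule sums_single)
  ultimately show ?thesis
    unfolding T_def multiplier_of_summand[OF y] by (simp only: sums_unique[symmetric])
qed

text \<open>
  By induction along the path from the root: the coupling term produced by \<open>e n\<close> replaces the phase
  of the parent by the phase of the node on the parent's node vector.
\<close>

lemma T_node_vector:
  assumes "finite A"
  shows "T t (node_vector e A) = scaleC (cis (frequency A * t)) (node_vector e A)"
  using assms
proof (induction A rule: finite_linorder_max_induct)
  case empty
  then show ?case
    using T_summand[OF e_in, of t 0]
    by (simp add: node_vector_def frequency_def coupling_zero scaleC.zero_left)
next
  case (insert b A)
  define n where "n = set_encode (insert b A)"
  have n: "level n = b" "parent n = A" "set_decode n = insert b A"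
    using level_insert[of A b] insert.hyps by (auto simp: n_def)
  let ?c = "cis (frequency (insert b A) * t)" and ?c' = "cis (frequency A * t)"
  have v: "node_vector e (insert b A) = node_vector e A + scaleC (of_real ((1/2) ^ b)) (e n)"
    unfolding scaleC_of_real n_def using insert.hyps by (intro node_vector_insert) auto
  have "edge_vector e n = scaleC (of_real (2 ^ b)) (node_vector e A)"
    unfolding edge_vector_def n by (simp only: scaleC_of_real)
  then have "T t (e n) = scaleC ?c (e n) + scaleC ((?c - ?c') * of_real (2 ^ b)) (node_vector e A)"
    unfolding T_summand[OF e_in] by (simp add: coupling_def n f_e scaleC_scaleC)
  moreover have "complex_of_real ((1/2) ^ b) * ((?c - ?c') * of_real (2 ^ b)) = ?c - ?c'"
    by (simp add: power_one_over)
  ultimately have "T t (scaleC (of_real ((1/2) ^ b)) (e n))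
      = scaleC ?c (scaleC (of_real ((1/2) ^ b)) (e n)) + scaleC (?c - ?c') (node_vector e A)"
    by (simp only: T_scaleC scaleC_add_right scaleC_scaleC mult.commute)
  then show ?case
    unfolding v T_add insert.IH by (simp add: scaleC_add_right scaleC.diff_left)
qed

text \<open>
  On a summand the law is the identity \<open>c\<^sub>t (c\<^sub>s - d\<^sub>s) + (c\<^sub>t - d\<^sub>t) d\<^sub>s = c\<^sub>s c\<^sub>t - d\<^sub>s d\<^sub>t\<close> for the phases \<open>c\<close> of the
  node and \<open>d\<close> of its parent, because the edge vector is an eigenvector with the phase \<open>d\<close>.
\<close>

lemma T_plus: "T (s + t) x = T s (T t x)"
proof (rule eq_on_summands_imp_eq[OF bounded_linear_T bounded_linear_compose[OF bounded_linear_T bounded_linear_T]])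
  fix l y assume y: "y \<in> E l"
  let ?c = "\<lambda>r. cis (frequency (set_decode l) * r)" and ?d = "\<lambda>r. cis (frequency (parent l) * r)"
  let ?v = "edge_vector e l"
  have "finite (parent l)" by (simp add: parent_def)
  then have Tv: "T s ?v = scaleC (?d s) ?v"
    using T_node_vector[of "parent l" s] T_scaleC[of s "complex_of_real (2 ^ level l)" "node_vector e (parent l)"]
    by (simp only: edge_vector_def scaleC_of_real[symmetric] scaleC_scaleC mult.commute)
  have "T s (T t y) = scaleC (?c t) (T s y) + scaleC (coupling t l * f l y) (T s ?v)"
    unfolding T_summand[OF y, of t] by (simp only: T_add T_scaleC)
  also have "\<dots> = scaleC (?c t * ?c s) y
      + scaleC ((?c t * coupling s l + coupling t l * ?d s) * f l y) ?v"
    unfolding T_summand[OF y, of s] Tv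
    by (simp add: scaleC_add_right scaleC_scaleC scaleC_add_left algebra_simps)
  also have "?c t * ?c s = ?c (s + t)"
    by (simp add: cis_mult algebra_simps)
  also have "?c t * coupling s l + coupling t l * ?d s = coupling (s + t) l"
    by (simp add: coupling_def cis_mult algebra_simps)
  finally show "T (s + t) y = T s (T t y)"
    unfolding T_summand[OF y, of "s + t"] by simp
qed

lemma T_zero: "T 0 x = x"
  by (rule eq_on_summands_imp_eq[OF bounded_linear_T bounded_linear_ident])
     (simp add: T_summand coupling_def scaleC_one scaleC.zero_left)

lemma T_continuous:
  assumes s: "s \<ge> 0"
  shows "((\<lambda>t. T t x) \<longlongrightarrow> T s x) (at s within {0..})"
proof -
  obtain c where c: "\<And>M t x. coupled M t \<Longrightarrow> norm (T t x) \<le> (c + 2 * M) * norm x"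
    using T_bound by blast
  have "continuous_on {0..<s + 1} (\<lambda>t. T t x)"
  proof (rule continuous_on_orbit)
    fix t x assume t: "t \<in> {0..<s + 1}"
    show "linear (T t)"
      by (rule bounded_linear.linear[OF bounded_linear_T])
    have "norm (T t x) \<le> (c + 2 * \<bar>t\<bar>) * norm x"
      by (rule c[OF coupled_abs])
    also have "\<dots> \<le> (c + 2 * (s + 1)) * norm x"
      using t by (intro mult_right_mono) auto
    finally show "norm (T t x) \<le> (c + 2 * (s + 1)) * norm x" .
  next
    fix l y assume "y \<in> E l"
    then show "continuous_on {0..<s + 1} (\<lambda>t. T t y)"
      unfolding T_summand[OF \<open>y \<in> E l\<close>] coupling_def
      by (intro continuous_intros scaleC.continuous_on)
  qed
  then have "((\<lambda>t. T t x) \<longlongrightarrow> T s x) (at s within {0..<s + 1})"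
    using s by (simp add: continuous_on)
  moreover have "at s within {0..<s + 1} = at s within {0..}"
    by (rule at_within_nhd[of _ "{..<s + 1}"]) auto
  ultimately show ?thesis by simp
qed

lemma c0_semigroup_T: "c0_semigroup space_of_type T"
  unfolding c0_semigroup_def
proof (intro conjI allI impI ballI)
  fix t :: real
  have "\<exists>K. \<forall>x. norm (T t x) \<le> K * norm x"
    using bounded_linear.bounded[OF bounded_linear_T] by (simp add: mult.commute)
  then show "cs_bounded_operator space_of_type (T t)"
    by (simp add: cs_bounded_operator_def T_add T_scaleC)
next
  fix x and s :: real assume "s \<ge> 0"
  then show "((\<lambda>t. cs_norm space_of_type (cs_diff space_of_type (T t x) (T s x))) \<longlongrightarrow> 0) (at s within {0..})"
    using T_continuous[of s x] by (simp add: tendsto_norm_zero LIM_zero)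
qed (simp_all add: T_zero T_plus)

lemma partially_bounded_T:
  assumes "\<And>b k. cmod (cis (\<theta> b * t k) - 1) \<le> \<delta> b"
  shows "partially_bounded space_of_type t T"
proof -
  obtain c where c: "\<And>M t x. coupled M t \<Longrightarrow> norm (T t x) \<le> (c + 2 * M) * norm x" "c \<ge> 0"
    using T_bound by blast
  have "cs_opnorm space_of_type (T (t k)) \<le> c + 2" for k
    unfolding cs_opnorm_def
  proof (rule cSUP_least)
    show "{x \<in> cs_carrier space_of_type. cs_norm space_of_type (x :: 'a) \<le> 1} \<noteq> {}"
      by (auto intro: exI[of _ 0])
    fix x :: 'a assume "x \<in> {x \<in> cs_carrier space_of_type. cs_norm space_of_type x \<le> 1}"
    then have "norm x \<le> 1" by simp
    have "norm (T (t k) x) \<le> (c + 2 * 1) * norm x"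
      by (rule c(1)) (use assms in \<open>simp add: coupled_def\<close>)
    also have "\<dots> \<le> (c + 2 * 1) * 1"
      using \<open>norm x \<le> 1\<close> c(2) by (intro mult_left_mono) auto
    finally show "cs_norm space_of_type (T (t k) x) \<le> c + 2" by simp
  qed
  then show ?thesis
    unfolding partially_bounded_def by (intro bdd_aboveI2)
qed

definition branch_frequency :: "nat set \<Rightarrow> real" where
  "branch_frequency B = (\<Sum>b. if b \<in> B then \<theta> b else 0)"

lemma theta_geometric: "\<theta> (b + j) \<le> \<theta> b * (1/3) ^ j"
proof (induction j)
  case (Suc j)
  then show ?case using theta_third[of "b + j"] by simp
qed simp

lemma theta_summable: "summable (\<lambda>b. if b \<in> B then \<theta> b else 0)"
proof (rule summable_comparison_test'[of "\<lambda>b. \<theta> 0 * (1/3) ^ b" 0])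
  show "norm (if b \<in> B then \<theta> b else 0) \<le> \<theta> 0 * (1/3) ^ b" for b
    using theta_geometric[of 0 b] theta_pos[of b] theta_pos[of 0] by auto
qed (intro summable_mult summable_geometric, simp)

text \<open>
  At the first level where two branches differ, the increment \<open>\<theta> b\<close> exceeds the sum of all later
  increments, which is at most \<open>\<theta> b / 2\<close>.
\<close>

lemma branch_frequency_less:
  assumes b: "b \<in> B" "b \<notin> B'" and agree: "\<And>c. c < b \<Longrightarrow> c \<in> B \<longleftrightarrow> c \<in> B'"
  shows "branch_frequency B' < branch_frequency B"
proof -
  define g where "g = (\<lambda>B c. if c \<in> B then \<theta> c else 0)"
  have split: "branch_frequency B = (\<Sum>j. g B (j + Suc b)) + (\<Sum>c<Suc b. g B c)" for B
    unfolding branch_frequency_def g_def by (rule suminf_split_initial_segment[OF theta_summable])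
  have "(\<Sum>c<b. g B c) = (\<Sum>c<b. g B' c)"
    by (rule sum.cong) (use agree in \<open>auto simp: g_def\<close>)
  then have head: "(\<Sum>c<Suc b. g B c) = (\<Sum>c<Suc b. g B' c) + \<theta> b"
    using b by (simp add: g_def)
  have tail_summable: "summable (\<lambda>j. g B (j + Suc b))" for B
    using theta_summable[of B] unfolding g_def by (subst summable_iff_shift)
  have geo: "(\<lambda>j. \<theta> b / 3 * (1/3) ^ j) sums (\<theta> b / 2)"
    using sums_mult[OF geometric_sums[of "1/3::real"], of "\<theta> b / 3"] by simp
  have "(\<Sum>j. g B' (j + Suc b)) \<le> (\<Sum>j. \<theta> b / 3 * (1/3) ^ j)"
  proof (rule suminf_le[OF _ tail_summable sums_summable[OF geo]])
    show "g B' (j + Suc b) \<le> \<theta> b / 3 * (1/3) ^ j" for j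
      using theta_geometric[of b "Suc j"] theta_pos[of b] by (auto simp: g_def add.commute)
  qed
  then have "(\<Sum>j. g B' (j + Suc b)) \<le> \<theta> b / 2"
    using sums_unique[OF geo] by simp
  moreover have "0 \<le> (\<Sum>j. g B (j + Suc b))"
    by (rule suminf_nonneg[OF tail_summable]) (use theta_pos in \<open>auto simp: g_def less_imp_le\<close>)
  ultimately show ?thesis
    using split[of B] split[of B'] head theta_pos[of b] by linarith
qed

lemma inj_branch_frequency: "inj branch_frequency"
proof (rule injI, rule ccontr)
  fix B B' assume eq: "branch_frequency B = branch_frequency B'" and "B \<noteq> B'"
  define b where "b = (LEAST c. (c \<in> B) \<noteq> (c \<in> B'))"
  have ex: "\<exists>c. (c \<in> B) \<noteq> (c \<in> B')" using \<open>B \<noteq> B'\<close> by blast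
  have b: "(b \<in> B) \<noteq> (b \<in> B')"
    unfolding b_def by (rule LeastI_ex[OF ex])
  have agree: "c \<in> B \<longleftrightarrow> c \<in> B'" if "c < b" for c
    using not_less_Least[of c "\<lambda>c. (c \<in> B) \<noteq> (c \<in> B')"] that by (simp add: b_def)
  show False
    using branch_frequency_less[of b B B'] branch_frequency_less[of b B' B] b agree eq by auto
qed

text \<open>
  The eigenvector is the limit of the node vectors along the branch. It is nonzero because all of
  them have the coordinate 1 at the root.
\<close>

lemma branch_eigenvector: "\<exists>u. u \<noteq> 0 \<and> (\<forall>t. T t u = scaleC (cis (branch_frequency B * t)) u)"
proof -
  define w where "w = (\<lambda>b. if b \<in> B then (1/2) ^ b *\<^sub>R e (set_encode (B \<inter> {..b})) else 0)"
  define A where "A = (\<lambda>m. B \<inter> {..<m})"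
  have A: "finite (A m)" for m by (simp add: A_def)
  have sum_if: "(\<Sum>b\<in>A m. g b) = (\<Sum>b<m. if b \<in> B then g b else 0)" for m and g :: "nat \<Rightarrow> 'b::comm_monoid_add"
    using sum.inter_restrict[of "{..<m}" g B] by (simp add: A_def Int_commute)
  have "A m \<inter> {..b} = B \<inter> {..b}" if "b \<in> A m" for m b
    using that by (auto simp: A_def)
  then have nv: "node_vector e (A m) = e 0 + (\<Sum>b<m. w b)" for m
    by (simp add: node_vector_def w_def sum_if[symmetric] cong: sum.cong)
  have "summable w"
    by (rule summable_comparison_test'[OF summable_geometric[of "1/2::real"], of 0])
       (auto simp: w_def norm_e)
  define u where "u = e 0 + suminf w"
  have nv_lim: "(\<lambda>m. node_vector e (A m)) \<longlonglongrightarrow> u"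
    unfolding nv u_def by (intro tendsto_intros summable_LIMSEQ \<open>summable w\<close>)
  have freq_lim: "(\<lambda>m. frequency (A m)) \<longlonglongrightarrow> branch_frequency B"
    unfolding frequency_def sum_if branch_frequency_def by (rule summable_LIMSEQ[OF theta_summable])
  have "T t u = scaleC (cis (branch_frequency B * t)) u" for t
  proof (rule LIMSEQ_unique)
    show "(\<lambda>m. T t (node_vector e (A m))) \<longlonglongrightarrow> T t u"
      by (rule bounded_linear.tendsto[OF bounded_linear_T nv_lim])
    show "(\<lambda>m. T t (node_vector e (A m))) \<longlonglongrightarrow> scaleC (cis (branch_frequency B * t)) u"
      unfolding T_node_vector[OF A]
      by (intro scaleC.tendsto nv_lim tendsto_intros freq_lim)
  qed
  moreover have "u \<noteq> 0"
  proof -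
    have "f 0 (node_vector e (A m)) = 1" for m
    proof -
      have "f 0 ((1/2) ^ b *\<^sub>R e (set_encode (A m \<inter> {..b}))) = 0" if "b \<in> A m" for b
      proof -
        have "set_encode (A m \<inter> {..b}) \<noteq> 0"
          using that A[of m] by (metis IntI atMost_iff empty_iff finite_Int order_refl set_decode_zero set_encode_inverse)
        then show ?thesis
          by (simp add: linear_scale[OF linear_f] f_e)
      qed
      then show ?thesis
        unfolding node_vector_def by (simp add: linear_add[OF linear_f] linear_sum[OF linear_f] f_e)
    qed
    then have "f 0 u = 1"
      using bounded_linear.tendsto[OF bounded_linear_f nv_lim, of 0] by (simp add: LIMSEQ_const_iff)
    then show ?thesis
      using linear_0[OF linear_f] by force
  qed
  ultimately show ?thesis by blast
qed

lemma branch_frequency_in_spectrum: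
  "\<i> * of_real (branch_frequency B) \<in> imaginary_point_spectrum space_of_type T"
proof -
  define z where "z = \<i> * complex_of_real (branch_frequency B)"
  obtain u where u: "u \<noteq> 0" "\<And>t. T t u = scaleC (cis (branch_frequency B * t)) u"
    using branch_eigenvector by blast
  have "((\<lambda>h. cmod ((exp (z * of_real h) - 1) / of_real h - z) * norm u)
      \<longlongrightarrow> cmod (z - z) * norm u) (at_right 0)"
    by (intro tendsto_intros exp_difference_quotient)
  moreover have "scaleC (of_real (1 / h)) (T h u - u) - scaleC z u
      = scaleC ((exp (z * of_real h) - 1) / of_real h - z) u" for h
  proof -
    have "T h u = scaleC (exp (z * of_real h)) u"
      unfolding u(2) cis_conv_exp z_def by (simp add: mult.assoc)
    then have "T h u - u = scaleC (exp (z * of_real h) - 1) u"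
      by (simp add: scaleC.diff_left scaleC_one)
    then show ?thesis
      by (simp only: scaleC_scaleC scaleC.diff_left[symmetric]) simp
  qed
  ultimately have "(u, scaleC z u) \<in> generator space_of_type T"
    by (simp add: generator_def norm_scaleC)
  then show ?thesis
    using u(1) unfolding imaginary_point_spectrum_def point_spectrum_def z_def[symmetric]
    by (auto simp: z_def)
qed

lemma uncountable_imaginary_point_spectrum:
  "uncountable (imaginary_point_spectrum space_of_type T)"
proof
  let ?g = "\<lambda>B. \<i> * complex_of_real (branch_frequency B)"
  assume "countable (imaginary_point_spectrum space_of_type T)"
  then have "countable (range ?g)"
    by (rule countable_subset[rotated]) (use branch_frequency_in_spectrum in auto)
  moreover have "inj ?g"
    using inj_branch_frequency by (auto simp: inj_def)
  ultimately have "countable (UNIV :: nat set set)"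
    by (rule countable_image_inj_on)
  then show False
    using nat_sets_eqpoll_reals uncountable_UNIV_real unfolding eqpoll_def
    by (metis uncountable_bij_betw)
qed

end

text \<open>
  Each level carries only finitely many nodes, so one bound per level serves all of them.
\<close>

lemma edge_cost_dominated:
  fixes K :: "nat \<Rightarrow> real"
  assumes K: "\<And>n. K n \<ge> 0"
  obtains \<delta> :: "nat \<Rightarrow> real" where "\<And>b. \<delta> b > 0" "\<And>n. n \<noteq> 0 \<Longrightarrow> \<delta> (level n) * K n \<le> (1/2) ^ n"
proof -
  define \<eta> where "\<eta> = (\<lambda>n. (1/2) ^ n / (1 + K n))"
  define \<delta> where "\<delta> = (\<lambda>b. Min (\<eta> ` set_encode ` Pow {..b}))"
  have \<eta>: "\<eta> n > 0" for n
    using K[of n] by (auto simp: \<eta>_def intro!: divide_pos_pos)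
  show thesis
  proof (rule that[of \<delta>])
    show "\<delta> b > 0" for b
      unfolding \<delta>_def using \<eta> by (subst Min_gr_iff) auto
    fix n :: nat assume "n \<noteq> 0"
    have "set_decode n \<subseteq> {..level n}"
      by (auto simp: level_def)
    then have "\<eta> (set_encode (set_decode n)) \<in> \<eta> ` set_encode ` Pow {..level n}"
      by blast
    then have "\<delta> (level n) \<le> \<eta> n"
      unfolding \<delta>_def by (intro Min_le) auto
    then have "\<delta> (level n) * K n \<le> \<eta> n * K n"
      using K by (intro mult_right_mono)
    also have "\<dots> = (1/2) ^ n * (K n / (1 + K n))"
      by (simp add: \<eta>_def)
    also have "\<dots> \<le> (1/2) ^ n * 1"
      using K[of n] by (intro mult_left_mono) (auto simp: divide_le_eq)
    finally show "\<delta> (level n) * K n \<le> (1/2) ^ n" by simp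
  qed
qed

section \<open>Small phases from a sequence that is not Jamison\<close>

text \<open>
  The definition of the generator only controls right derivatives of orbits, hence a one-sided
  monotonicity principle is needed. The comparison with the line of slope \<open>e\<close> holds on a largest
  interval \<open>{0..u}\<close>, which the growth condition would extend if \<open>u < t\<close>.
\<close>

lemma le_zero_if_right_growth_le:
  fixes h :: "real \<Rightarrow> real"
  assumes cont: "continuous_on {0..} h" and h0: "h 0 \<le> 0" and t: "t \<ge> 0"
    and growth: "\<And>s e. s \<ge> 0 \<Longrightarrow> e > 0 \<Longrightarrow> \<forall>\<^sub>F r in at_right 0. h (s + r) \<le> h s + e * r"
  shows "h t \<le> 0"
proof -
  have bound: "h t \<le> e * t" if e: "e > 0" for e
  proof -
    define A where "A = {s \<in> {0..t}. h s - e * s \<le> 0}"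
    define good where "good = {s \<in> {0..t}. {0..s} \<subseteq> A}"
    have "closed A"
      unfolding A_def
      by (intro continuous_on_closed_Collect_le continuous_intros continuous_on_subset[OF cont]) auto
    define u where "u = Sup good"
    have g0: "0 \<in> good" using h0 t by (auto simp: good_def A_def)
    have bdd: "bdd_above good" by (rule bdd_aboveI[of _ t]) (auto simp: good_def)
    have u0: "0 \<le> u" unfolding u_def by (rule cSup_upper[OF g0 bdd])
    have ut: "u \<le> t" unfolding u_def by (rule cSup_least) (use g0 in \<open>auto simp: good_def\<close>)
    have below: "s \<in> A" if "0 \<le> s" "s < u" for s
    proof -
      obtain s' where "s' \<in> good" "s < s'"
        using \<open>s < u\<close> less_cSup_iff[OF _ bdd, of s] g0 unfolding u_def by blast
      then show ?thesis using that by (auto simp: good_def)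
    qed
    have uA: "u \<in> A"
    proof (cases "u = 0")
      case True
      then show ?thesis using h0 t by (auto simp: A_def)
    next
      case False
      then have "u \<in> closure {0..<u}" using u0 by simp
      moreover have "closure {0..<u} \<subseteq> A"
        using below \<open>closed A\<close> by (intro closure_minimal) auto
      ultimately show ?thesis by blast
    qed
    have "u = t"
    proof (rule ccontr)
      assume "u \<noteq> t"
      then have "u < t" using ut by simp
      have "\<forall>\<^sub>F r in at_right 0. h (u + r) \<le> h u + e * r" by (rule growth[OF u0 e])
      then obtain b where b: "b > 0" "\<And>r. 0 < r \<Longrightarrow> r < b \<Longrightarrow> h (u + r) \<le> h u + e * r"
        unfolding eventually_at_right_field by auto
      define c where "c = min (b / 2) (t - u)"
      have c: "0 < c" "c < b" "u + c \<le> t"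
        using b \<open>u < t\<close> by (auto simp: c_def min_def)
      have "s \<in> A" if "0 \<le> s" "s \<le> u + c" for s
      proof (cases "s \<le> u")
        case True
        then show ?thesis using below uA that by (cases "s = u") auto
      next
        case False
        then have "h s \<le> h u + e * (s - u)" using b(2)[of "s - u"] that c by auto
        then show ?thesis using uA that c by (auto simp: A_def algebra_simps)
      qed
      then have "u + c \<in> good" using u0 c by (auto simp: good_def)
      from cSup_upper[OF this bdd] show False using c by (simp add: u_def)
    qed
    then show ?thesis using uA by (simp add: A_def)
  qed
  have "h t / (t + 1) \<le> e" if "e > 0" for e
    using bound[OF that] that t by (simp add: divide_le_eq algebra_simps)
  then have "h t / (t + 1) \<le> 0"
    by (rule field_le_epsilon) simp
  then show ?thesis
    using t by (simp add: divide_le_0_iff)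
qed

context cs_banach
begin

lemma diff_scale_right:
  assumes "x \<in> cs_carrier S" "y \<in> cs_carrier S"
  shows "cs_diff S (cs_scale S a x) (cs_scale S a y) = cs_scale S a (cs_diff S x y)"
  using assms by (simp add: cs_diff_def scale_add_right scale_closed scale_scale mult.commute)

lemma diff_scale_left:
  assumes "x \<in> cs_carrier S"
  shows "cs_diff S (cs_scale S a x) (cs_scale S b x) = cs_scale S (a - b) x"
  using assms scale_add_left[of x a "- b"] by (simp add: cs_diff_def scale_scale)

lemma operator_diff:
  assumes T: "cs_bounded_operator S T" and x: "x \<in> cs_carrier S" and y: "y \<in> cs_carrier S"
  shows "T (cs_diff S x y) = cs_diff S (T x) (T y)"
  using T x y scale_closed[OF y] by (simp add: cs_diff_def cs_bounded_operator_def)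

lemma norm_operator_le:
  assumes T: "cs_bounded_operator S T" and x: "x \<in> cs_carrier S"
  shows "cs_norm S (T x) \<le> cs_opnorm S T * cs_norm S x"
proof (cases "cs_norm S x = 0")
  case True
  obtain K where "cs_norm S (T x) \<le> K * cs_norm S x"
    using T x by (auto simp: cs_bounded_operator_def)
  then show ?thesis using True by simp
next
  case False
  then have pos: "cs_norm S x > 0" using norm_nonneg[OF x] by simp
  obtain K where K: "\<And>y. y \<in> cs_carrier S \<Longrightarrow> cs_norm S (T y) \<le> K * cs_norm S y"
    using T unfolding cs_bounded_operator_def by blast
  define c where "c = complex_of_real (1 / cs_norm S x)"
  have c: "cmod c = 1 / cs_norm S x"
    unfolding c_def norm_of_real using pos by simp
  have "cs_norm S (T (cs_scale S c x)) \<le> cs_opnorm S T"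
    unfolding cs_opnorm_def
  proof (rule cSUP_upper)
    show "cs_scale S c x \<in> {x \<in> cs_carrier S. cs_norm S x \<le> 1}"
      using pos x by (simp add: scale_closed norm_scale c)
    show "bdd_above ((\<lambda>x. cs_norm S (T x)) ` {x \<in> cs_carrier S. cs_norm S x \<le> 1})"
    proof (rule bdd_aboveI2)
      fix y assume y: "y \<in> {x \<in> cs_carrier S. cs_norm S x \<le> 1}"
      then have "cs_norm S (T y) \<le> \<bar>K\<bar> * cs_norm S y"
        using K[of y] mult_right_mono[OF abs_ge_self[of K] norm_nonneg[of y]] by simp
      also have "\<dots> \<le> \<bar>K\<bar> * 1"
        using y by (intro mult_left_mono) auto
      finally show "cs_norm S (T y) \<le> \<bar>K\<bar>" by simp
    qed
  qed
  moreover have "T (cs_scale S c x) = cs_scale S c (T x)" "T x \<in> cs_carrier S"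
    using T x by (auto simp: cs_bounded_operator_def)
  ultimately show ?thesis
    using pos by (simp add: norm_scale c field_simps)
qed

lemma generator_invariant:
  assumes T: "c0_semigroup S T" and s: "s \<ge> 0" and x: "(x, cs_scale S z x) \<in> generator S T"
  shows "(T s x, cs_scale S z (T s x)) \<in> generator S T"
proof -
  have op: "cs_bounded_operator S (T t)" if "t \<ge> 0" for t
    using T that by (simp add: c0_semigroup_def)
  have xS: "x \<in> cs_carrier S"
    using x by (simp add: generator_def)
  have closed: "T t y \<in> cs_carrier S" if "t \<ge> 0" "y \<in> cs_carrier S" for t y
    using op[OF that(1)] that(2) by (simp add: cs_bounded_operator_def)
  have scale: "T s (cs_scale S a y) = cs_scale S a (T s y)" if "y \<in> cs_carrier S" for a y
    using op[OF s] that by (simp add: cs_bounded_operator_def)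
  have comm: "T h (T s x) = T s (T h x)" if "h \<ge> 0" for h
  proof -
    have "T (h + s) x = T h (T s x)" "T (s + h) x = T s (T h x)"
      using T that s xS by (auto simp: c0_semigroup_def)
    then show ?thesis by (simp add: add.commute)
  qed
  let ?q = "\<lambda>h. cs_diff S (cs_scale S (complex_of_real (1 / h)) (cs_diff S (T h x) x)) (cs_scale S z x)"
  let ?q' = "\<lambda>h. cs_diff S (cs_scale S (complex_of_real (1 / h)) (cs_diff S (T h (T s x)) (T s x)))
    (cs_scale S z (T s x))"
  have q: "?q h \<in> cs_carrier S" "?q' h = T s (?q h)" if "h > 0" for h
    using that xS s by (simp_all add: closed diff_closed scale_closed operator_diff[OF op] scale comm)
  have "((\<lambda>h. cs_norm S (?q' h)) \<longlongrightarrow> 0) (at_right 0)"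
  proof (rule tendsto_sandwich)
    show "\<forall>\<^sub>F h in at_right 0. 0 \<le> cs_norm S (?q' h)"
      by (rule eventually_mono[OF eventually_at_right_less]) (simp only: q(2) norm_nonneg closed[OF s q(1)])
    show "\<forall>\<^sub>F h in at_right 0. cs_norm S (?q' h) \<le> cs_opnorm S (T s) * cs_norm S (?q h)"
      by (rule eventually_mono[OF eventually_at_right_less])
         (simp only: q(2) norm_operator_le[OF op[OF s] q(1)])
    have "((\<lambda>h. cs_opnorm S (T s) * cs_norm S (?q h)) \<longlongrightarrow> cs_opnorm S (T s) * 0) (at_right 0)"
      using x by (intro tendsto_intros) (simp add: generator_def)
    then show "((\<lambda>h. cs_opnorm S (T s) * cs_norm S (?q h)) \<longlongrightarrow> 0) (at_right 0)"
      by simp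
  qed simp
  then show ?thesis
    using xS s by (simp add: generator_def closed scale_closed)
qed

text \<open>
  Both the orbit and the exponential agree with \<open>(1 + r z) x\<close> to first order.
\<close>

lemma generator_growth:
  assumes T: "c0_semigroup S T" and x: "(x, cs_scale S z x) \<in> generator S T" and e: "e > 0"
  shows "\<forall>\<^sub>F r in at_right 0. cs_norm S (cs_diff S (T r x) (cs_scale S (exp (z * of_real r)) x)) \<le> e * r"
proof -
  let ?q = "\<lambda>h. cs_diff S (cs_scale S (complex_of_real (1 / h)) (cs_diff S (T h x) x)) (cs_scale S z x)"
  have xS: "x \<in> cs_carrier S"
    using x by (simp add: generator_def)
  have TS: "T t x \<in> cs_carrier S" if "t \<ge> 0" for t
    using T that xS by (simp add: c0_semigroup_def cs_bounded_operator_def)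
  have "((\<lambda>h. cs_norm S (?q h)) \<longlongrightarrow> 0) (at_right 0)"
    using x by (simp add: generator_def)
  then have 1: "\<forall>\<^sub>F h in at_right 0. cs_norm S (?q h) < e / 2"
    using e by (intro order_tendstoD(2)) auto
  have "((\<lambda>h. cmod ((exp (z * of_real h) - 1) / of_real h - z) * cs_norm S x)
      \<longlongrightarrow> cmod (z - z) * cs_norm S x) (at_right 0)"
    by (intro tendsto_intros exp_difference_quotient)
  then have 2: "\<forall>\<^sub>F h in at_right 0. cmod ((exp (z * of_real h) - 1) / of_real h - z) * cs_norm S x < e / 2"
    using e by (intro order_tendstoD(2)[of _ 0]) auto
  show ?thesis
    using 1 2 eventually_at_right_less[of 0]
  proof eventually_elim
    case (elim r)
    let ?E = "exp (z * of_real r)"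
    define w where "w = 1 + of_real r * z"
    have r: "r > 0" using elim by simp
    have "cs_scale S (of_real r) (?q r) = cs_diff S (T r x) (cs_scale S w x)"
    proof -
      have "cs_scale S (of_real r) (?q r) = cs_diff S (cs_diff S (T r x) x) (cs_scale S (of_real r * z) x)"
        using r xS TS[of r]
        by (simp add: diff_scale_right[symmetric] diff_closed scale_closed scale_scale scale_one)
      also have "\<dots> = cs_diff S (T r x) (cs_scale S w x)"
        using r xS TS[of r]
        by (simp add: cs_diff_def add_assoc scale_closed scale_scale scale_add_left[symmetric] w_def)
      finally show ?thesis .
    qed
    then have a: "cs_norm S (cs_diff S (T r x) (cs_scale S w x)) = r * cs_norm S (?q r)"
      using norm_scale[of "?q r" "of_real r"] r xS TS[of r] by (simp add: diff_closed scale_closed)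
    have "w - ?E = - of_real r * ((?E - 1) / of_real r - z)"
      using r by (simp add: w_def scaleR_conv_of_real field_simps)
    then have b: "cs_norm S (cs_diff S (cs_scale S w x) (cs_scale S ?E x))
        = r * (cmod ((?E - 1) / of_real r - z) * cs_norm S x)"
      using r xS by (simp add: diff_scale_left norm_scale norm_mult)
    have "cs_norm S (cs_diff S (T r x) (cs_scale S ?E x))
        \<le> r * cs_norm S (?q r) + r * (cmod ((?E - 1) / of_real r - z) * cs_norm S x)"
      using norm_diff_triangle[of "T r x" "cs_scale S w x" "cs_scale S ?E x"] r xS TS[of r] a b
      by (simp add: scale_closed)
    also have "\<dots> \<le> r * (e / 2) + r * (e / 2)"
      using elim r by (intro add_mono mult_left_mono) auto
    finally show ?case by (simp add: mult.commute)
  qed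
qed

text \<open>
  The distance \<open>h\<close> between the orbit and the exponential grows at most at rate zero at every
  time: the first-order estimate applies at the point \<open>T s x\<close>, which is again an eigenvector of the
  generator, and multiplication by \<open>exp (z r)\<close> is isometric since \<open>z\<close> is imaginary.
\<close>

lemma orbit_of_eigenvector:
  assumes T: "c0_semigroup S T" and x: "(x, cs_scale S z x) \<in> generator S T"
    and z: "Re z = 0" and t: "t \<ge> 0"
  shows "T t x = cs_scale S (exp (z * of_real t)) x"
proof -
  have xS: "x \<in> cs_carrier S"
    using x by (simp add: generator_def)
  have TS: "T t y \<in> cs_carrier S" if "t \<ge> 0" "y \<in> cs_carrier S" for t y
    using T that by (simp add: c0_semigroup_def cs_bounded_operator_def)
  define E where "E = (\<lambda>s. exp (z * complex_of_real s))"
  have E1: "cmod (E s) = 1" for s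
    using z by (simp add: E_def)
  have E_add: "E (s + r) = E r * E s" for s r
    by (simp add: E_def exp_add[symmetric] algebra_simps)
  define h where "h = (\<lambda>s. cs_norm S (cs_diff S (T s x) (cs_scale S (E s) x)))"
  have tri: "h s \<le> h r + cs_norm S (cs_diff S (T s x) (T r x)) + cmod (E r - E s) * cs_norm S x"
    if "s \<ge> 0" "r \<ge> 0" for s r
  proof -
    have "h s \<le> cs_norm S (cs_diff S (T s x) (T r x)) + cs_norm S (cs_diff S (T r x) (cs_scale S (E s) x))"
      unfolding h_def using that xS by (intro norm_diff_triangle TS scale_closed)
    also have "cs_norm S (cs_diff S (T r x) (cs_scale S (E s) x)) \<le>
        h r + cs_norm S (cs_diff S (cs_scale S (E r) x) (cs_scale S (E s) x))"
      unfolding h_def using that xS by (intro norm_diff_triangle TS scale_closed)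
    finally show ?thesis
      using xS by (simp add: diff_scale_left norm_scale)
  qed
  have cont: "continuous_on {0..} h"
    unfolding continuous_on
  proof
    fix s :: real assume s: "s \<in> {0..}"
    let ?d = "\<lambda>r. cs_norm S (cs_diff S (T r x) (T s x)) + cmod (E s - E r) * cs_norm S x"
    have "((\<lambda>r. cs_norm S (cs_diff S (T r x) (T s x))) \<longlongrightarrow> 0) (at s within {0..})"
      using T s xS by (simp add: c0_semigroup_def)
    moreover have "((\<lambda>r. cmod (E s - E r) * cs_norm S x) \<longlongrightarrow> cmod (E s - E s) * cs_norm S x) (at s within {0..})"
      unfolding E_def by (intro tendsto_intros)
    ultimately have "(?d \<longlongrightarrow> 0 + cmod (E s - E s) * cs_norm S x) (at s within {0..})"
      by (rule tendsto_add)
    then have lim: "(?d \<longlongrightarrow> 0) (at s within {0..})" by simp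
    have "\<bar>h r - h s\<bar> \<le> ?d r" if r: "r \<ge> 0" for r
      using tri[of r s] tri[of s r] r s norm_diff_commute[OF TS[OF r xS] TS[of s, OF _ xS]]
      by (simp add: norm_minus_commute abs_le_iff)
    then have "((\<lambda>r. h r - h s) \<longlongrightarrow> 0) (at s within {0..})"
      by (intro Lim_null_comparison[OF _ lim]) (auto simp: eventually_at_filter)
    then show "(h \<longlongrightarrow> h s) (at s within {0..})"
      by (rule LIM_zero_cancel)
  qed
  have "h t \<le> 0"
  proof (rule le_zero_if_right_growth_le[OF cont _ t])
    have "cs_norm S (cs_zero S) = 0"
      using norm_eq_zero zero_closed by blast
    then show "h 0 \<le> 0"
      using T xS add_scale_minus_one[OF xS] by (simp add: h_def E_def c0_semigroup_def scale_one cs_diff_def)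
  next
    fix s e :: real assume s: "s \<ge> 0" and e: "e > 0"
    from generator_growth[OF T generator_invariant[OF T s x] e] eventually_at_right_less[of 0]
    show "\<forall>\<^sub>F r in at_right 0. h (s + r) \<le> h s + e * r"
    proof eventually_elim
      case (elim r)
      have T_add: "T (s + r) x = T r (T s x)"
        using T s elim xS by (metis add.commute c0_semigroup_def less_imp_le)
      have "h (s + r) \<le> cs_norm S (cs_diff S (T r (T s x)) (cs_scale S (E r) (T s x)))
          + cs_norm S (cs_diff S (cs_scale S (E r) (T s x)) (cs_scale S (E (s + r)) x))"
        unfolding h_def T_add using s elim xS by (intro norm_diff_triangle TS scale_closed) auto
      also have "cs_diff S (cs_scale S (E r) (T s x)) (cs_scale S (E (s + r)) x)
          = cs_scale S (E r) (cs_diff S (T s x) (cs_scale S (E s) x))"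
        using s xS TS by (simp add: E_add scale_scale[symmetric] diff_scale_right scale_closed)
      also have "cs_norm S \<dots> = h s"
        using s xS TS by (simp add: h_def norm_scale E1 diff_closed scale_closed)
      finally show ?case
        using elim by (simp add: E_def)
    qed
  qed
  then have "h t = 0"
    using norm_nonneg[OF diff_closed[OF TS[OF t xS] scale_closed[OF xS, of "E t"]]] by (simp add: h_def)
  then show ?thesis
    unfolding h_def E_def by (rule norm_diff_eq_zero[OF TS[OF t xS] scale_closed[OF xS]])
qed

lemma unit_eigenvector:
  assumes T: "c0_semigroup S T" and z: "z \<in> imaginary_point_spectrum S T"
  shows "\<exists>x\<in>cs_carrier S. cs_norm S x = 1 \<and> (\<forall>t\<ge>0. T t x = cs_scale S (exp (z * of_real t)) x)"
proof -
  obtain x where x: "x \<in> cs_carrier S" "x \<noteq> cs_zero S" "(x, cs_scale S z x) \<in> generator S T"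
    and "Re z = 0"
    using z by (auto simp: imaginary_point_spectrum_def point_spectrum_def)
  then have orbit: "T t x = cs_scale S (exp (z * of_real t)) x" if "t \<ge> 0" for t
    using orbit_of_eigenvector[OF T] that by blast
  define c where "c = complex_of_real (1 / cs_norm S x)"
  have "cs_norm S x > 0"
    using x norm_nonneg[of x] norm_eq_zero[of x] by fastforce
  then have "cmod c * cs_norm S x = 1"
    unfolding c_def norm_of_real by simp
  moreover have "T t (cs_scale S c x) = cs_scale S (exp (z * of_real t)) (cs_scale S c x)" if "t \<ge> 0" for t
  proof -
    have "T t (cs_scale S c x) = cs_scale S c (T t x)"
      using T that x by (simp add: c0_semigroup_def cs_bounded_operator_def)
    then show ?thesis
      using x orbit[OF that] by (simp add: scale_scale mult.commute)
  qed
  ultimately show ?thesis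
    using x by (intro bexI[of _ "cs_scale S c x"]) (auto simp: norm_scale scale_closed)
qed

end

text \<open>
  Among uncountably many eigenvalues there are two different ones that are almost equal and have almost
  equal unit eigenvectors, because the space is separable and the line is covered by countably many
  short intervals. The operators \<open>T (t k)\<close> are uniformly bounded, so the phases of the two eigenvalues
  at all times \<open>t k\<close> are close; \<open>\<theta>\<close> is the difference of the eigenvalues.
\<close>

lemma small_phase_if_not_jamison:
  assumes t: "admissible_sequence t" and nj: "\<not> jamison_sequence t" and e: "e > 0"
  shows "\<exists>\<theta>>0. \<theta> < e \<and> (\<forall>k. cmod (cis (\<theta> * t k) - 1) \<le> e)"
proof -
  obtain S :: "real cspace" and T where S: "cs_banach S" and sep: "cs_separable S"
    and T: "c0_semigroup S T" and bdd: "partially_bounded S t T"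
    and unc: "uncountable (imaginary_point_spectrum S T)"
    using t nj unfolding jamison_sequence_def by blast
  interpret cs_banach S by (rule S)
  have tk: "t k \<ge> 0" for k
    using t by (simp add: admissible_sequence_def less_imp_le)
  define Z where "Z = imaginary_point_spectrum S T"
  have Re: "Re z = 0" if "z \<in> Z" for z
    using that by (simp add: Z_def imaginary_point_spectrum_def)
  obtain x where x: "\<And>z. z \<in> Z \<Longrightarrow> x z \<in> cs_carrier S" "\<And>z. z \<in> Z \<Longrightarrow> cs_norm S (x z) = 1"
    "\<And>z s. z \<in> Z \<Longrightarrow> s \<ge> 0 \<Longrightarrow> T s (x z) = cs_scale S (exp (z * of_real s)) (x z)"
    using unit_eigenvector[OF T] unfolding Z_def by metis
  obtain M where M: "\<And>k. cs_opnorm S (T (t k)) \<le> M"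
    using bdd by (auto simp: partially_bounded_def bdd_above_def)
  \<comment> \<open>the two eigenvectors will have distance at most \<open>2 * \<delta>\<close>, which is amplified by \<open>\<bar>M\<bar> + 1\<close>\<close>
  define \<delta> where "\<delta> = e / (2 * (\<bar>M\<bar> + 1))"
  have \<delta>: "\<delta> > 0" using e by (auto simp: \<delta>_def intro!: divide_pos_pos)
  obtain D where D: "countable D" "D \<subseteq> cs_carrier S"
    "\<And>y. y \<in> cs_carrier S \<Longrightarrow> \<exists>d\<in>D. cs_norm S (cs_diff S y d) < \<delta>"
    using sep \<delta> unfolding cs_separable_def by meson
  obtain d where d: "\<And>z. z \<in> Z \<Longrightarrow> d z \<in> D" "\<And>z. z \<in> Z \<Longrightarrow> cs_norm S (cs_diff S (x z) (d z)) < \<delta>"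
    using D(3)[OF x(1)] by metis
  define c where "c = (\<lambda>z. (d z, \<lfloor>Im z / e\<rfloor>))"
  have "\<not> inj_on c Z"
  proof
    assume "inj_on c Z"
    moreover have "countable (c ` Z)"
      by (rule countable_subset[of _ "D \<times> UNIV"]) (use d D(1) in \<open>auto simp: c_def\<close>)
    ultimately show False
      using unc countable_image_inj_on unfolding Z_def by blast
  qed
  then obtain z z' where zz: "z \<in> Z" "z' \<in> Z" "c z = c z'" "Im z' < Im z"
    using Re unfolding inj_on_def by (metis complex_eq_iff linorder_neqE_linordered_idom)
  define \<theta> where "\<theta> = Im z - Im z'"
  have "\<bar>Im z / e - Im z' / e\<bar> < 1"
    using zz(3) by (simp add: c_def) linarith
  then have \<theta>: "\<theta> > 0" "\<theta> < e"
    using zz(4) e by (auto simp: \<theta>_def field_simps)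
  have near: "cs_norm S (cs_diff S (x z) (x z')) < 2 * \<delta>"
    using norm_diff_triangle[of "x z" "d z" "x z'"] norm_diff_commute[of "d z" "x z'"] d[OF zz(1)] d[OF zz(2)]
      zz(3) x(1)[OF zz(1)] x(1)[OF zz(2)] D(2) by (auto simp: c_def subset_iff)
  have "cmod (cis (\<theta> * t k) - 1) \<le> e" for k
  proof -
    let ?E = "exp (z * of_real (t k))" and ?E' = "exp (z' * of_real (t k))"
    have op: "cs_bounded_operator S (T (t k))"
      using T tk by (simp add: c0_semigroup_def)
    have xs: "x z \<in> cs_carrier S" "x z' \<in> cs_carrier S"
      using x zz by auto
    have "z * of_real (t k) = \<i> * of_real (\<theta> * t k) + z' * of_real (t k)"
      using Re[OF zz(1)] Re[OF zz(2)] by (simp add: complex_eq_iff \<theta>_def algebra_simps)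
    then have "?E = cis (\<theta> * t k) * ?E'" "cmod ?E' = 1"
      using Re[OF zz(2)] by (simp_all add: cis_conv_exp exp_add)
    then have "cmod (cis (\<theta> * t k) - 1) = cmod (?E - ?E')"
      by (metis mult.right_neutral mult_1 norm_mult left_diff_distrib)
    also have "\<dots> = cs_norm S (cs_diff S (cs_scale S ?E (x z)) (cs_scale S ?E' (x z)))"
      using xs x(2)[OF zz(1)] by (simp add: diff_scale_left norm_scale)
    also have "\<dots> \<le> cs_norm S (cs_diff S (cs_scale S ?E (x z)) (cs_scale S ?E' (x z')))
        + cs_norm S (cs_diff S (cs_scale S ?E' (x z')) (cs_scale S ?E' (x z)))"
      using xs by (intro norm_diff_triangle scale_closed)
    also have "cs_diff S (cs_scale S ?E (x z)) (cs_scale S ?E' (x z')) = T (t k) (cs_diff S (x z) (x z'))"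
      using x(3)[OF zz(1) tk] x(3)[OF zz(2) tk] operator_diff[OF op xs] by simp
    also have "cs_norm S (cs_diff S (cs_scale S ?E' (x z')) (cs_scale S ?E' (x z)))
        = cs_norm S (cs_diff S (x z) (x z'))"
      using xs \<open>cmod ?E' = 1\<close> norm_diff_commute[OF xs]
      by (simp add: diff_scale_right norm_scale diff_closed)
    also have "cs_norm S (T (t k) (cs_diff S (x z) (x z'))) \<le> \<bar>M\<bar> * cs_norm S (cs_diff S (x z) (x z'))"
      using norm_operator_le[OF op diff_closed[OF xs]] M[of k] norm_nonneg[OF diff_closed[OF xs]]
      by (meson abs_ge_self mult_right_mono order_trans)
    finally have "cmod (cis (\<theta> * t k) - 1) \<le> (\<bar>M\<bar> + 1) * cs_norm S (cs_diff S (x z) (x z'))"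
      by (simp add: algebra_simps)
    also have "\<dots> \<le> (\<bar>M\<bar> + 1) * (2 * \<delta>)"
      using near by (intro mult_left_mono) auto
    also have "(\<bar>M\<bar> + 1) * (2 * \<delta>) = e"
      using abs_ge_zero[of M] by (simp add: \<delta>_def field_simps del: abs_ge_zero)
    finally show ?thesis .
  qed
  then show ?thesis
    using \<theta> by blast
qed

section \<open>Universality\<close>

theorem theorem3p12:
  assumes "separable_space (euclidean :: 'a::complex_banach topology)"
    and "\<exists>E :: nat \<Rightarrow> 'a set. unconditional_schauder_decomposition E"
  shows "universal_jamison_space TYPE('a)"
  unfolding universal_jamison_space_def
proof (intro conjI allI impI)
  obtain E :: "nat \<Rightarrow> 'a set" where E: "unconditional_schauder_decomposition E"
    using assms(2) by blast
  show "infinite_dimensional TYPE('a)"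
    by (rule infinite_dimensional_if_decomposition[OF E])
  interpret unconditional_decomposition E
    by unfold_locales (rule E)
  obtain e f where ef: "biorthogonal e f"
    using biorthogonal_exists by blast
  define K where "K = (\<lambda>n. onorm (f n) * norm (edge_vector e n))"
  have K: "K n \<ge> 0" for n
    unfolding K_def by (intro mult_nonneg_nonneg onorm_pos_le biorthogonalD(3)[OF ef] norm_ge_zero)
  obtain \<delta> where \<delta>: "\<And>b. \<delta> b > 0" "\<And>n. n \<noteq> 0 \<Longrightarrow> \<delta> (level n) * K n \<le> (1/2) ^ n"
    using edge_cost_dominated[of K, OF K] by blast
  fix t :: "nat \<Rightarrow> real" assume t: "admissible_sequence t \<and> \<not> jamison_sequence t"
  have small: "\<exists>\<theta>>0. \<theta> < \<epsilon> \<and> (\<forall>k. cmod (cis (\<theta> * t k) - 1) \<le> \<epsilon>)" if "\<epsilon> > 0" for \<epsilon>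
    using small_phase_if_not_jamison[OF _ _ that] t by blast
  \<comment> \<open>the increments are chosen one level at a time, below both the bound for their level and a
    third of the preceding increment\<close>
  have "\<exists>\<theta>. \<forall>b. (\<theta> b > 0 \<and> \<theta> b \<le> \<delta> b \<and> (\<forall>k. cmod (cis (\<theta> b * t k) - 1) \<le> \<delta> b))
      \<and> \<theta> (Suc b) \<le> \<theta> b / 3"
  proof (rule dependent_nat_choice)
    show "\<exists>x. x > 0 \<and> x \<le> \<delta> 0 \<and> (\<forall>k. cmod (cis (x * t k) - 1) \<le> \<delta> 0)"
      using small[OF \<delta>(1)[of 0]] by (auto intro: less_imp_le)
  next
    fix x :: real and b assume "x > 0 \<and> x \<le> \<delta> b \<and> (\<forall>k. cmod (cis (x * t k) - 1) \<le> \<delta> b)"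
    then have "min (\<delta> (Suc b)) (x / 3) > 0"
      using \<delta>(1) by simp
    from small[OF this] obtain y where "y > 0" "y < min (\<delta> (Suc b)) (x / 3)"
      "\<forall>k. cmod (cis (y * t k) - 1) \<le> min (\<delta> (Suc b)) (x / 3)" by blast
    then show "\<exists>y. (y > 0 \<and> y \<le> \<delta> (Suc b) \<and> (\<forall>k. cmod (cis (y * t k) - 1) \<le> \<delta> (Suc b))) \<and> y \<le> x / 3"
      by (intro exI[of _ y]) auto
  qed
  then obtain \<theta> where \<theta>: "\<And>b. \<theta> b > 0" "\<And>b. \<theta> b \<le> \<delta> b"
    "\<And>b k. cmod (cis (\<theta> b * t k) - 1) \<le> \<delta> b" "\<And>b. \<theta> (Suc b) \<le> \<theta> b / 3"
    by blast
  interpret tree_semigroup E e f \<theta> \<delta>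
    by unfold_locales (use ef \<theta> \<delta>(2) in \<open>auto simp: K_def\<close>)
  show "\<exists>T. c0_semigroup (space_of_type :: 'a cspace) T \<and>
      partially_bounded (space_of_type :: 'a cspace) t T \<and>
      uncountable (imaginary_point_spectrum (space_of_type :: 'a cspace) T)"
    using c0_semigroup_T partially_bounded_T[of t, OF \<theta>(3)] uncountable_imaginary_point_spectrum by blast
qed (rule assms(1))

end
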